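(* Let $X$ be an irreducible sofic shift and $\pi: X\to Y$ a finite-to-one factor code. Let $\nu$ be a fully supported ergodic measure on $Y$. If $\lambda$ and $\lambda'$ are degree joinings over $\nu$, then there is a permutation $f$ of $\{1,\dots,d_\pi\}$ such that $\lambda'=p_f\lambda$, where $p_f:X^{d_\pi}\to X^{d_\pi}$ is the map $p_f(x_1,\dots,x_{d_\pi})=(x_{f(1)},\dots,x_{f(d_\pi)})$ and $p_f\lambda$ is the pushforward.
   Context: Shift spaces are two-sided with finite alphabet; "measure" means Borel probability measure, and "ergodic measure" means an ergodic shift-invariant measure. A factor code is a shift-commuting continuous surjection between shift spaces. For a finite-to-one factor code $\pi$ on an irreducible sofic shift, every doubly transitive point of $Y$ has the same finite number of preimages; this number is the degree $d_\pi$. An $n$-fold ($\pi$-)relative joining is a measure $\lambda$ on $X^n$, invariant under the product (diagonal) shift action, such that the set $X^n_\pi=\{(x^{(1)},\dots,x^{(n)})\in X^n:\pi(x^{(1)})=\dots=\pi(x^{(n)})\}$ has full $\lambda$-measure. With $p_i:X^n\to X$ the $i$-th coordinate projection, it is a relative joining over $\nu$ if $\pi p_i\lambda=\nu$ for some (hence every) $i$ (maps applied to measures mean pushforward). It is separating if for $\lambda$-a.e. $(x^{(1)},\dots,x^{(n)})$ the points $x^{(1)},\dots,x^{(n)}$ are $n$ distinct points. A degree joining over $\nu$ (with respect to $\pi$) is an ergodic $d_\pi$-fold separating relative joining over $\nu$. *)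

theory Defs
  imports "HOL-Probability.Probability" "HOL-Combinatorics.Permutations"
begin

section \<open>Shift spaces and factor codes\<close>

text \<open>
  Symbols live in a type of class \<open>discrete_topology\<close>, so that \<open>int \<Rightarrow> 'a\<close> carries the product
  topology of discrete spaces. The type itself may be infinite; finiteness of the alphabet is part
  of \<open>shift_space\<close>.
\<close>

definition shift_map :: "(int \<Rightarrow> 'a) \<Rightarrow> int \<Rightarrow> 'a" where
  "shift_map x = (\<lambda>i. x (i + 1))"

definition shift_space :: "(int \<Rightarrow> 'a::discrete_topology) set \<Rightarrow> bool" where
  "shift_space X \<longleftrightarrow> finite (\<Union>x\<in>X. range x) \<and> closed X \<and> shift_map ` X = X"

definition block :: "(int \<Rightarrow> 'a) \<Rightarrow> int \<Rightarrow> nat \<Rightarrow> 'a list" where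
  "block x i n = map (\<lambda>k. x (i + int k)) [0..<n]"

definition language :: "(int \<Rightarrow> 'a) set \<Rightarrow> 'a list set" where
  "language X = {block x i n | x i n. x \<in> X}"

definition irreducible_shift :: "(int \<Rightarrow> 'a) set \<Rightarrow> bool" where
  "irreducible_shift X \<longleftrightarrow> (\<forall>u\<in>language X. \<forall>v\<in>language X. \<exists>w. u @ w @ v \<in> language X)"

text \<open>
  A sofic shift is the set of label sequences of bi-infinite walks on a finite labelled graph
  (Lind and Marcus). The graph is given by its set of edges (source, label, target), with states
  named by natural numbers; parallel edges with equal labels would not change the label sequences.
\<close>

definition sofic_shift :: "(int \<Rightarrow> 'a) set \<Rightarrow> bool" where
  "sofic_shift X \<longleftrightarrow>
     (\<exists>E :: (nat \<times> 'a \<times> nat) set. finite E \<and>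
        X = {x. \<exists>q :: int \<Rightarrow> nat. \<forall>i. (q i, x i, q (i + 1)) \<in> E})"

definition factor_code ::
  "(int \<Rightarrow> 'a::discrete_topology) set \<Rightarrow> (int \<Rightarrow> 'b::discrete_topology) set
    \<Rightarrow> ((int \<Rightarrow> 'a) \<Rightarrow> (int \<Rightarrow> 'b)) \<Rightarrow> bool" where
  "factor_code X Y \<pi> \<longleftrightarrow>
     shift_space X \<and> shift_space Y \<and> continuous_on X \<pi> \<and> \<pi> ` X = Y \<and>
     (\<forall>x\<in>X. \<pi> (shift_map x) = shift_map (\<pi> x))"

definition finite_to_one ::
  "(int \<Rightarrow> 'a) set \<Rightarrow> (int \<Rightarrow> 'b) set \<Rightarrow> ((int \<Rightarrow> 'a) \<Rightarrow> (int \<Rightarrow> 'b)) \<Rightarrow> bool" where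
  "finite_to_one X Y \<pi> \<longleftrightarrow> (\<forall>y\<in>Y. finite {x\<in>X. \<pi> x = y})"

text \<open>
  Every word of \<open>Y\<close> occurs in \<open>y\<close> arbitrarily far to the right and arbitrarily far to the left.
\<close>

definition doubly_transitive :: "(int \<Rightarrow> 'a) set \<Rightarrow> (int \<Rightarrow> 'a) \<Rightarrow> bool" where
  "doubly_transitive Y y \<longleftrightarrow> y \<in> Y \<and>
     (\<forall>w\<in>language Y. \<forall>N. (\<exists>i\<ge>N. block y i (length w) = w) \<and>
                            (\<exists>i\<le>N. block y i (length w) = w))"

definition code_degree ::
  "(int \<Rightarrow> 'a) set \<Rightarrow> (int \<Rightarrow> 'b) set \<Rightarrow> ((int \<Rightarrow> 'a) \<Rightarrow> (int \<Rightarrow> 'b)) \<Rightarrow> nat" where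
  "code_degree X Y \<pi> =
     (THE d. \<forall>y. doubly_transitive Y y \<longrightarrow>
        finite {x\<in>X. \<pi> x = y} \<and> card {x\<in>X. \<pi> x = y} = d)"


section \<open>Invariant measures and relative joinings\<close>

abbreviation borel_on :: "'c::topological_space set \<Rightarrow> 'c measure" where
  "borel_on X \<equiv> restrict_space borel X"

text \<open>
  Points of the power \<open>X ^ n\<close> are extensional functions on \<open>{1..n}\<close>. Shift spaces are second countable, so the
  product sigma-algebra is the Borel sigma-algebra of the product.
\<close>

abbreviation borel_power :: "nat \<Rightarrow> 'c::topological_space set \<Rightarrow> (nat \<Rightarrow> 'c) measure" where
  "borel_power n X \<equiv> PiM {1..n} (\<lambda>_. borel_on X)"

definition power_shift :: "nat \<Rightarrow> (nat \<Rightarrow> int \<Rightarrow> 'a) \<Rightarrow> (nat \<Rightarrow> int \<Rightarrow> 'a)" where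
  "power_shift n x = (\<lambda>i\<in>{1..n}. shift_map (x i))"

definition coord_map :: "nat \<Rightarrow> (nat \<Rightarrow> nat) \<Rightarrow> (nat \<Rightarrow> 'c) \<Rightarrow> (nat \<Rightarrow> 'c)" where
  "coord_map n f x = (\<lambda>i\<in>{1..n}. x (f i))"

definition invariant_prob :: "('c \<Rightarrow> 'c) \<Rightarrow> 'c measure \<Rightarrow> bool" where
  "invariant_prob T M \<longleftrightarrow> prob_space M \<and> T \<in> measurable M M \<and> distr M M T = M"

definition ergodic_prob :: "('c \<Rightarrow> 'c) \<Rightarrow> 'c measure \<Rightarrow> bool" where
  "ergodic_prob T M \<longleftrightarrow> invariant_prob T M \<and>
     (\<forall>A\<in>sets M. T -` A \<inter> space M = A \<longrightarrow> measure M A = 0 \<or> measure M A = 1)"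

definition ergodic_measure_on ::
  "(int \<Rightarrow> 'a::discrete_topology) set \<Rightarrow> (int \<Rightarrow> 'a) measure \<Rightarrow> bool" where
  "ergodic_measure_on Y \<nu> \<longleftrightarrow> sets \<nu> = sets (borel_on Y) \<and> ergodic_prob shift_map \<nu>"

definition fully_supported_on :: "'c::topological_space set \<Rightarrow> 'c measure \<Rightarrow> bool" where
  "fully_supported_on Y \<nu> \<longleftrightarrow> (\<forall>U. open U \<and> U \<inter> Y \<noteq> {} \<longrightarrow> measure \<nu> (U \<inter> Y) > 0)"

definition relative_joining ::
  "(int \<Rightarrow> 'a::discrete_topology) set \<Rightarrow> ((int \<Rightarrow> 'a) \<Rightarrow> (int \<Rightarrow> 'b)) \<Rightarrow> nat
    \<Rightarrow> (nat \<Rightarrow> int \<Rightarrow> 'a) measure \<Rightarrow> bool" where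
  "relative_joining X \<pi> n \<mu> \<longleftrightarrow>
     sets \<mu> = sets (borel_power n X) \<and> invariant_prob (power_shift n) \<mu> \<and>
     (AE x in \<mu>. \<forall>i\<in>{1..n}. \<forall>j\<in>{1..n}. \<pi> (x i) = \<pi> (x j))"

definition joining_over ::
  "(int \<Rightarrow> 'b::discrete_topology) set \<Rightarrow> ((int \<Rightarrow> 'a) \<Rightarrow> (int \<Rightarrow> 'b)) \<Rightarrow> nat
    \<Rightarrow> (int \<Rightarrow> 'b) measure \<Rightarrow> (nat \<Rightarrow> int \<Rightarrow> 'a) measure \<Rightarrow> bool" where
  "joining_over Y \<pi> n \<nu> \<mu> \<longleftrightarrow> (\<exists>i\<in>{1..n}. distr \<mu> (borel_on Y) (\<lambda>x. \<pi> (x i)) = \<nu>)"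

definition separating :: "nat \<Rightarrow> (nat \<Rightarrow> 'c) measure \<Rightarrow> bool" where
  "separating n \<mu> \<longleftrightarrow> (AE x in \<mu>. inj_on x {1..n})"

definition degree_joining ::
  "(int \<Rightarrow> 'a::discrete_topology) set \<Rightarrow> (int \<Rightarrow> 'b::discrete_topology) set
    \<Rightarrow> ((int \<Rightarrow> 'a) \<Rightarrow> (int \<Rightarrow> 'b)) \<Rightarrow> (int \<Rightarrow> 'b) measure
    \<Rightarrow> (nat \<Rightarrow> int \<Rightarrow> 'a) measure \<Rightarrow> bool" where
  "degree_joining X Y \<pi> \<nu> \<mu> \<longleftrightarrow>
     relative_joining X \<pi> (code_degree X Y \<pi>) \<mu> \<and>
     joining_over Y \<pi> (code_degree X Y \<pi>) \<nu> \<mu> \<and>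
     separating (code_degree X Y \<pi>) \<mu> \<and>
     ergodic_prob (power_shift (code_degree X Y \<pi>)) \<mu>"

end

theory Submission
  imports Defs
begin

text \<open>
  Let \<open>d\<close> be the degree. Almost every point for \<open>\<nu>\<close> is doubly transitive
  (\<open>AE_doubly_transitive\<close>) and a doubly transitive point has exactly \<open>d\<close> preimages
  (\<open>card_fibre_eq_code_degree\<close>). So for a degree joining almost every tuple lists all the points
  of a fibre, each of them once, and the only freedom is the order of the list. Adding up all
  rearrangements removes this freedom: on a cylinder given by \<open>d\<close> distinct windows the sum
  \<open>\<Sum>\<^sub>f p\<^sub>f \<mu>\<close> is the \<open>\<nu>\<close>-measure of the set of points whose fibre shows exactly these windows
  (\<open>symmetrised_injective_cylinder\<close>), and by separation these values determine the sum
  (\<open>symmetrised_unique\<close>). Hence \<open>\<mu>' \<le> \<Sum>\<^sub>f p\<^sub>f \<mu>' = \<Sum>\<^sub>f p\<^sub>f \<mu>\<close>. All the \<open>p\<^sub>f \<mu>\<close> are ergodic, and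
  distinct ergodic measures are mutually singular (\<open>ergodic_mutually_singular\<close>), so \<open>\<mu>'\<close> is one of
  them. This route avoids disintegration over \<open>\<nu>\<close> and the ergodic decomposition of a relatively
  independent joining.

  The constancy of the degree is proved directly for sofic shifts, without passing to a cover by a
  shift of finite type. A sofic shift has finitely many contexts of words, and therefore
  a synchronizing word \<open>m\<close>: points that agree around an occurrence of \<open>m\<close> can be spliced there
  (\<open>glue\<close>). A finite-to-one code has no diamonds (\<open>no_diamond\<close>), so up to a constant \<open>X\<close> has no more
  words of length \<open>n\<close> than \<open>Y\<close>, and by a counting argument all preimages of a
  transitive point contain \<open>m\<close> (\<open>transitive_preimage_sees_sync\<close>). Now take a block of \<open>Y\<close> with as few
  windows over it as possible, among the blocks over which each window shows \<open>m\<close>. Wherever it occurs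
  in \<open>y\<close>, each of these windows extends to a preimage of \<open>y\<close> (\<open>magic_windows\<close>). If \<open>y\<close> is doubly
  transitive then the extension is unique (\<open>magic_window_injective\<close>): a place where two
  preimages branch could be copied arbitrarily far out, but finitely many preimages are told apart by a
  bounded window. So the number of preimages is the number of these windows, whatever \<open>y\<close> is.
\<close>

section \<open>Windows and blocks\<close>

definition shift_by :: "int \<Rightarrow> (int \<Rightarrow> 'a) \<Rightarrow> int \<Rightarrow> 'a" where
  "shift_by t x = (\<lambda>i. x (i + t))"

text \<open>
  Windows are extensional functions rather than lists, so that a window of smaller radius is
  literally the window of one of larger radius.
\<close>

definition window :: "nat \<Rightarrow> (int \<Rightarrow> 'a) \<Rightarrow> int \<Rightarrow> 'a" where
  "window N x = restrict x {- int N..int N}"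

lemma shift_by_0 [simp]: "shift_by 0 x = x"
  by (simp add: shift_by_def)

lemma shift_by_shift_by [simp]: "shift_by s (shift_by t x) = shift_by (s + t) x"
  by (simp add: shift_by_def ac_simps)

lemma shift_by_1: "shift_by 1 = shift_map"
  by (auto simp: shift_by_def shift_map_def)

lemma shift_by_apply: "shift_by t x i = x (i + t)"
  by (simp add: shift_by_def)

lemma window_eq_iff: "window N x = window N z \<longleftrightarrow> (\<forall>i. \<bar>i\<bar> \<le> int N \<longrightarrow> x i = z i)"
  unfolding window_def restrict_def fun_eq_iff by (auto simp: abs_le_iff)

lemma window_mono: "window M x = window M z \<Longrightarrow> N \<le> M \<Longrightarrow> window N x = window N z"
  unfolding window_eq_iff by force

lemma window_window: "N \<le> M \<Longrightarrow> window N (window M x) = window N x"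
  unfolding window_def restrict_def by (auto simp: fun_eq_iff)

lemma length_block [simp]: "length (block x i n) = n"
  by (simp add: block_def)

lemma nth_block [simp]: "k < n \<Longrightarrow> block x i n ! k = x (i + int k)"
  by (simp add: block_def)

lemma block_eq_iff: "block x i n = block z j n \<longleftrightarrow> (\<forall>k<n. x (i + int k) = z (j + int k))"
  by (simp add: list_eq_iff_nth_eq)

lemma block_eq_listI:
  assumes "length u = n" "\<And>k. k < n \<Longrightarrow> x (i + int k) = u ! k"
  shows "block x i n = u"
  using assms by (simp add: list_eq_iff_nth_eq)

lemma block_append: "block x i (m + n) = block x i m @ block x (i + int m) n"
  by (rule nth_equalityI) (auto simp: nth_append)

lemma block_shift_by: "block (shift_by t x) i n = block x (i + t) n"
  unfolding block_def shift_by_def by (simp add: ac_simps)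

lemma window_eq_block:
  "window N x = window N z \<longleftrightarrow> block x (- int N) (2 * N + 1) = block z (- int N) (2 * N + 1)"
  unfolding window_eq_iff block_eq_iff
proof (intro iffI allI impI)
  fix i assume *: "\<forall>k<2 * N + 1. x (- int N + int k) = z (- int N + int k)" and "\<bar>i\<bar> \<le> int N"
  then have "nat (i + int N) < 2 * N + 1" "- int N + int (nat (i + int N)) = i" by auto
  then show "x i = z i" using *[rule_format, of "nat (i + int N)"] by simp
qed auto

lemma finite_separating_window:
  assumes "finite (F :: (int \<Rightarrow> 'a) set)"
  obtains T where "inj_on (window T) F"
proof -
  have "\<exists>T. \<forall>p\<in>F \<times> F. fst p \<noteq> snd p \<longrightarrow> window T (fst p) \<noteq> window T (snd p)"
  proof -
    have "\<exists>T. \<forall>p\<in>G. fst p \<noteq> snd p \<longrightarrow> window T (fst p) \<noteq> window T (snd p)"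
      if "finite G" for G :: "((int \<Rightarrow> 'a) \<times> (int \<Rightarrow> 'a)) set"
      using that
    proof induction
      case (insert p G)
      obtain T where T: "\<forall>p\<in>G. fst p \<noteq> snd p \<longrightarrow> window T (fst p) \<noteq> window T (snd p)"
        using insert by blast
      have "\<exists>S. fst p \<noteq> snd p \<longrightarrow> window S (fst p) \<noteq> window S (snd p)"
      proof (cases "fst p = snd p")
        case False
        then obtain i where "fst p i \<noteq> snd p i" by blast
        then have "window (nat \<bar>i\<bar>) (fst p) \<noteq> window (nat \<bar>i\<bar>) (snd p)"
          unfolding window_eq_iff by force
        then show ?thesis by blast
      qed simp
      then obtain S where S: "fst p \<noteq> snd p \<longrightarrow> window S (fst p) \<noteq> window S (snd p)" by blast
      have "window (max S T) (fst p') \<noteq> window (max S T) (snd p')"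
        if "p' \<in> insert p G" "fst p' \<noteq> snd p'" for p'
        using S T that window_mono[of "max S T" "fst p'" "snd p'" S]
          window_mono[of "max S T" "fst p'" "snd p'" T] by auto
      then show ?case by blast
    qed simp
    from this[of "F \<times> F"] assms show ?thesis by simp
  qed
  then obtain T where T: "\<forall>p\<in>F \<times> F. fst p \<noteq> snd p \<longrightarrow> window T (fst p) \<noteq> window T (snd p)"
    by blast
  show ?thesis
  proof (rule that, rule inj_onI, rule ccontr)
    fix x z assume "x \<in> F" "z \<in> F" "window T x = window T z" "x \<noteq> z"
    then show False using T[rule_format, of "(x, z)"] by simp
  qed
qed

lemma open_window_pred: "open {z :: int \<Rightarrow> 'a::discrete_topology. P (window N z)}"
proof (subst open_subopen, safe)
  fix x :: "int \<Rightarrow> 'a" assume x: "P (window N x)"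
  let ?T = "\<Inter>i\<in>{- int N..int N}. (\<lambda>z. z i) -` {x i}"
  have "open ?T"
    by (intro open_INT ballI open_vimage continuous_on_product_coordinates
        discrete_topology_class.open_discrete) simp
  moreover have "x \<in> ?T" by simp
  moreover have "?T \<subseteq> {z. P (window N z)}"
  proof
    fix z assume "z \<in> ?T"
    then have "window N z = window N x" unfolding window_eq_iff by (auto simp: abs_le_iff)
    then show "z \<in> {z. P (window N z)}" using x by simp
  qed
  ultimately show "\<exists>T. open T \<and> x \<in> T \<and> T \<subseteq> {z. P (window N z)}" by blast
qed

lemma closed_window_pred: "closed {z :: int \<Rightarrow> 'a::discrete_topology. P (window N z)}"
  unfolding closed_def using open_window_pred[of "\<lambda>w. \<not> P w" N]
  by (simp add: Compl_eq)

text \<open>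
  A basic neighbourhood in a product of discrete spaces fixes finitely many coordinates, and
  these lie in a central window. Together with \<open>open_window_pred\<close> this reduces the topology to
  windows.
\<close>

lemma open_contains_window:
  assumes "open U" "(x :: int \<Rightarrow> 'a::discrete_topology) \<in> U"
  obtains N where "\<And>z. window N z = window N x \<Longrightarrow> z \<in> U"
proof -
  have "openin (product_topology (\<lambda>i. euclidean) UNIV) U"
    using assms(1) by (simp only: euclidean_product_topology open_openin)
  from product_topology_open_contains_basis[OF this assms(2)]
  obtain V where V: "x \<in> (\<Pi>\<^sub>E i\<in>UNIV. V i)" "finite {i. V i \<noteq> UNIV}" "(\<Pi>\<^sub>E i\<in>UNIV. V i) \<subseteq> U"
    unfolding topspace_euclidean by (elim exE conjE)
  from V(2) obtain N where N: "\<And>i. V i \<noteq> UNIV \<Longrightarrow> \<bar>i\<bar> \<le> int N"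
  proof -
    have "finite ((\<lambda>i. nat \<bar>i\<bar>) ` {i. V i \<noteq> UNIV})" using V(2) by simp
    then obtain N where "\<forall>n\<in>(\<lambda>i. nat \<bar>i\<bar>) ` {i. V i \<noteq> UNIV}. n \<le> N"
      using finite_nat_set_iff_bounded_le by blast
    then have "\<bar>i\<bar> \<le> int N" if "V i \<noteq> UNIV" for i
      using that by (auto dest!: bspec[of _ _ "nat \<bar>i\<bar>"])
    then show ?thesis by (rule that)
  qed
  have "z \<in> U" if "window N z = window N x" for z
  proof -
    have "z i \<in> V i" for i
    proof (cases "V i = UNIV")
      case False
      then have "z i = x i" using N that unfolding window_eq_iff by blast
      then show ?thesis using V(1) by auto
    qed simp
    then show ?thesis using V(3) by auto
  qed
  then show ?thesis by (rule that)
qed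

lemma shift_space_closedI:
  assumes "shift_space X" and "\<And>N. \<exists>z\<in>X. window N z = window N x"
  shows "x \<in> X"
proof (rule ccontr)
  assume "x \<notin> X"
  moreover have "open (- X)" using assms(1) unfolding shift_space_def by (simp add: open_Compl)
  ultimately obtain N where N: "\<And>z. window N z = window N x \<Longrightarrow> z \<in> - X"
    using open_contains_window[of "- X" x] by blast
  obtain z where "z \<in> X" "window N z = window N x" using assms(2) by blast
  then show False using N by simp
qed

lemma shift_space_shift_by:
  assumes "shift_space X" "x \<in> X"
  shows "shift_by t x \<in> X"
proof -
  have X: "shift_map ` X = X" using assms(1) unfolding shift_space_def by blast
  have 1: "shift_by 1 z \<in> X" if "z \<in> X" for z
    using imageI[OF that, of shift_map] unfolding X shift_by_1 .
  have 2: "shift_by (-1) z \<in> X" if "z \<in> X" for z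
  proof -
    from that have "z \<in> shift_map ` X" unfolding X .
    then obtain z' where "z' \<in> X" "z = shift_by 1 z'" unfolding shift_by_1 by (rule imageE)
    then show ?thesis by simp
  qed
  show ?thesis
  proof (induction t rule: int_induct[of _ 0])
    case (step1 i)
    then show ?case using 1[of "shift_by i x"] by (simp add: add.commute)
  next
    case (step2 i)
    then show ?case using 2[of "shift_by i x"] by (simp add: add.commute)
  qed (use assms in simp)
qed

lemma shift_space_compact:
  assumes "shift_space (X :: (int \<Rightarrow> 'a::discrete_topology) set)"
  shows "compact X"
proof -
  let ?A = "\<Union>x\<in>X. range x"
  have "finite ?A" using assms unfolding shift_space_def by blast
  then have "compactin (product_topology (\<lambda>i. euclidean) UNIV) (\<Pi>\<^sub>E i\<in>(UNIV::int set). ?A)"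
    by (subst compactin_PiE) (auto simp: finite_imp_compact)
  then have "compact (\<Pi>\<^sub>E i\<in>(UNIV::int set). ?A)"
    by (simp add: euclidean_product_topology)
  moreover have "closed X" using assms unfolding shift_space_def by blast
  ultimately have "compact ((\<Pi>\<^sub>E i\<in>(UNIV::int set). ?A) \<inter> X)"
    by (rule compact_Int_closed)
  moreover have "(\<Pi>\<^sub>E i\<in>(UNIV::int set). ?A) \<inter> X = X" by auto
  ultimately show ?thesis by simp
qed

text \<open>
  The compactness argument behind all passages from "for every finite window there is a point"
  to "there is a point".
\<close>

lemma nested_closed_nonempty:
  assumes "shift_space X" and "\<And>n. closed (C n)" and "\<And>n. C (Suc n) \<subseteq> C n"
    and "\<And>n. X \<inter> C n \<noteq> {}"
  obtains x where "x \<in> X" "\<And>n. x \<in> C n"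
proof -
  have dec: "C n \<subseteq> C m" if "m \<le> n" for m n
    using lift_Suc_antimono_le[of C] assms(3) that by blast
  have "X \<inter> (\<Inter>n\<in>UNIV. C n) \<noteq> {}"
  proof (rule compact_imp_fip_image[OF shift_space_compact[OF assms(1)]])
    fix I :: "nat set" assume I: "finite I" 
    then obtain n where "\<forall>i\<in>I. i \<le> n" using finite_nat_set_iff_bounded_le by blast
    then have "X \<inter> C n \<subseteq> X \<inter> (\<Inter>i\<in>I. C i)" using dec by blast
    then show "X \<inter> \<Inter> (C ` I) \<noteq> {}" using assms(4) by blast
  qed (use assms in auto)
  then show ?thesis using that by blast
qed

section \<open>Languages of shift spaces\<close>

lemma block_in_language: "x \<in> X \<Longrightarrow> block x i n \<in> language X"
  unfolding language_def by blast

lemma language_factor: "a @ u @ b \<in> language X \<Longrightarrow> u \<in> language X"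
proof -
  assume "a @ u @ b \<in> language X"
  then obtain x i n where x: "x \<in> X" "a @ u @ b = block x i n" unfolding language_def by blast
  then have n: "n = length a + (length u + length b)" by (metis length_append length_block)
  have "u = block x (i + int (length a)) (length u)"
    using x(2) unfolding n block_append by (simp add: append_eq_append_conv)
  then show ?thesis using x(1) block_in_language by metis
qed

lemma language_prefix: "u @ b \<in> language X \<Longrightarrow> u \<in> language X"
  using language_factor[of "[]" u b] by simp

lemma language_suffix: "a @ u \<in> language X \<Longrightarrow> u \<in> language X"
  using language_factor[of a u "[]"] by simp

lemma shift_space_language_block:
  assumes "shift_space X" "u \<in> language X"
  obtains z where "z \<in> X" "block z i (length u) = u"
proof -
  obtain x j n where x: "x \<in> X" "u = block x j n" using assms(2) unfolding language_def by blast
  have "block (shift_by (j - i) x) i (length u) = u"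
    using x(2) by (simp add: block_shift_by)
  then show ?thesis using that shift_space_shift_by[OF assms(1) x(1)] by blast
qed

lemma shift_space_languageI:
  assumes "shift_space X" and "\<And>N. block x (- int N) (2 * N + 1) \<in> language X"
  shows "x \<in> X"
proof (rule shift_space_closedI[OF assms(1)])
  fix N
  obtain z where "z \<in> X" "block z (- int N) (length (block x (- int N) (2 * N + 1))) = block x (- int N) (2 * N + 1)"
    using shift_space_language_block[OF assms(1) assms(2)] by blast
  then show "\<exists>z\<in>X. window N z = window N x" unfolding window_eq_block by auto
qed

lemma shift_space_language_extend:
  assumes "shift_space X" "u \<in> language X"
  obtains v where "length v = n" "u @ v \<in> language X"
proof -
  obtain z where z: "z \<in> X" "block z 0 (length u) = u"
    using shift_space_language_block[OF assms] by blast
  have "u @ block z (int (length u)) n \<in> language X"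
    using block_in_language[OF z(1), of 0 "length u + n"] z(2) by (simp add: block_append)
  then show ?thesis using that[of "block z (int (length u)) n"] by simp
qed

lemma shift_space_language_alphabet:
  assumes "u \<in> language X" shows "set u \<subseteq> (\<Union>x\<in>X. range x)"
  using assms unfolding language_def block_def by (auto intro!: bexI rangeI)

lemma finite_language_length:
  assumes "shift_space X" shows "finite {u \<in> language X. length u = n}"
proof (rule finite_subset)
  show "{u \<in> language X. length u = n} \<subseteq> {u. set u \<subseteq> (\<Union>x\<in>X. range x) \<and> length u = n}"
    using shift_space_language_alphabet by blast
  show "finite {u. set u \<subseteq> (\<Union>x\<in>X. range x) \<and> length u = n}"
    using assms finite_lists_length_eq unfolding shift_space_def by blast
qed

lemma countable_language:
  assumes "shift_space X" shows "countable (language X)"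
proof -
  have "language X = (\<Union>n. {u \<in> language X. length u = n})" by auto
  also have "countable \<dots>"
    by (rule countable_UN) (auto intro: countable_finite finite_language_length[OF assms])
  finally show ?thesis .
qed

lemma finite_windows:
  assumes "shift_space X" shows "finite (window N ` X)"
proof (rule finite_subset)
  show "window N ` X \<subseteq> (\<Pi>\<^sub>E i\<in>{- int N..int N}. \<Union>x\<in>X. range x)"
    unfolding window_def by auto
  show "finite (\<Pi>\<^sub>E i\<in>{- int N..int N}. \<Union>x\<in>X. range x)"
    using assms unfolding shift_space_def by (intro finite_PiE) auto
qed

lemma doubly_transitive_shift_by:
  assumes "shift_space Y" "doubly_transitive Y y"
  shows "doubly_transitive Y (shift_by t y)"
  unfolding doubly_transitive_def block_shift_by
proof (intro conjI ballI allI)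
  show "shift_by t y \<in> Y"
    using assms shift_space_shift_by unfolding doubly_transitive_def by blast
  fix w and N :: int assume "w \<in> language Y"
  then obtain i j where ij: "i \<ge> N + t" "block y i (length w) = w" "j \<le> N + t" "block y j (length w) = w"
    using assms(2) unfolding doubly_transitive_def by meson
  show "\<exists>i\<ge>N. block y (i + t) (length w) = w" using ij by (intro exI[of _ "i - t"]) auto
  show "\<exists>i\<le>N. block y (i + t) (length w) = w" using ij by (intro exI[of _ "j - t"]) auto
qed

text \<open>
  Seen through windows, the orbit of a doubly transitive point comes back to every point of the
  shift in both directions, in particular to itself.
\<close>

lemma doubly_transitive_window:
  assumes "doubly_transitive Y y" "y' \<in> Y"
  shows "\<exists>t\<ge>T. window N (shift_by t y) = window N y'"
    and "\<exists>t\<le>T. window N (shift_by t y) = window N y'"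
proof -
  let ?w = "block y' (- int N) (2 * N + 1)"
  have w: "?w \<in> language Y" using block_in_language assms(2) by blast
  have *: "window N (shift_by (i + int N) y) = window N y'" if "block y i (length ?w) = ?w" for i
    using that by (simp add: window_eq_block block_shift_by)
  obtain i where "i \<ge> T - int N" "block y i (length ?w) = ?w"
    using assms(1) w unfolding doubly_transitive_def by meson
  then show "\<exists>t\<ge>T. window N (shift_by t y) = window N y'"
    using * by (intro exI[of _ "i + int N"]) auto
  obtain i where "i \<le> T - int N" "block y i (length ?w) = ?w"
    using assms(1) w unfolding doubly_transitive_def by meson
  then show "\<exists>t\<le>T. window N (shift_by t y) = window N y'"
    using * by (intro exI[of _ "i + int N"]) auto
qed

section \<open>Contexts and synchronizing words of sofic shifts\<close>

text \<open>
  Equality of contexts is the syntactic congruence of the language.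
\<close>

definition contexts :: "(int \<Rightarrow> 'a) set \<Rightarrow> 'a list \<Rightarrow> ('a list \<times> 'a list) set" where
  "contexts X u = {(a, b). a @ u @ b \<in> language X}"

text \<open>
  A path is cut out of a bi-infinite walk, so dead ends of the graph do no harm: every carried
  word is in the language.
\<close>

definition carries :: "(nat \<times> 'a \<times> nat) set \<Rightarrow> 'a list \<Rightarrow> nat \<Rightarrow> nat \<Rightarrow> bool" where
  "carries E u s t \<longleftrightarrow> (\<exists>q x i. (\<forall>k. (q k, x k, q (k + 1)) \<in> E) \<and>
     block x i (length u) = u \<and> q i = s \<and> q (i + int (length u)) = t)"

text \<open>
  Two walks that meet in a state can be spliced there.
\<close>

lemma carries_append: "carries E (u @ v) s t \<longleftrightarrow> (\<exists>r. carries E u s r \<and> carries E v r t)"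
proof
  assume "carries E (u @ v) s t"
  then obtain q x i where *: "\<forall>k. (q k, x k, q (k + 1)) \<in> E"
    "block x i (length u + length v) = u @ v" "q i = s" "q (i + int (length u + length v)) = t"
    unfolding carries_def length_append by blast
  have "block x i (length u) = u" "block x (i + int (length u)) (length v) = v"
    using *(2) unfolding block_append by simp_all
  then have "carries E u s (q (i + int (length u)))" "carries E v (q (i + int (length u))) t"
    using * unfolding carries_def by (auto simp: add.assoc intro!: exI[of _ q] exI[of _ x])
  then show "\<exists>r. carries E u s r \<and> carries E v r t" by blast
next
  assume "\<exists>r. carries E u s r \<and> carries E v r t"
  then obtain r q x i q' x' j where
    1: "\<forall>k. (q k, x k, q (k + 1)) \<in> E" "block x i (length u) = u" "q i = s"
       "q (i + int (length u)) = r" and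
    2: "\<forall>k. (q' k, x' k, q' (k + 1)) \<in> E" "block x' j (length v) = v" "q' j = r"
       "q' (j + int (length v)) = t"
    unfolding carries_def by blast
  define c where "c = i + int (length u)"
  define q2 where "q2 k = (if k < c then q k else q' (k - c + j))" for k
  define x2 where "x2 k = (if k < c then x k else x' (k - c + j))" for k
  have "(q2 k, x2 k, q2 (k + 1)) \<in> E" for k
  proof -
    consider "k + 1 < c" | "k + 1 = c" | "k \<ge> c" by linarith
    then show ?thesis
    proof cases
      case 2
      have "q c = q' j" using 1(4) \<open>q' j = r\<close> c_def by simp
      then show ?thesis using 1(1)[rule_format, of k] 2 unfolding q2_def x2_def by simp
    next
      case 3
      then show ?thesis using 2(1)[rule_format, of "k - c + j"]
        unfolding q2_def x2_def by (simp add: algebra_simps)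
    qed (use 1(1) in \<open>auto simp: q2_def x2_def\<close>)
  qed
  moreover have "block x2 i (length (u @ v)) = u @ v"
  proof -
    have "block x2 i (length u) = block x i (length u)"
      unfolding block_eq_iff x2_def c_def by simp
    moreover have "block x2 c (length v) = block x' j (length v)"
      unfolding block_eq_iff x2_def by (simp add: algebra_simps)
    ultimately show ?thesis using 1(2) 2(2) by (simp add: block_append c_def)
  qed
  moreover have "q2 i = s"
  proof (cases "u = []")
    case True
    then show ?thesis using 1(3,4) 2(3) by (simp add: q2_def c_def)
  qed (use 1(3) in \<open>simp add: q2_def c_def\<close>)
  moreover have "q2 (i + int (length (u @ v))) = t"
    using 2(4) by (simp add: q2_def c_def algebra_simps)
  ultimately show "carries E (u @ v) s t" unfolding carries_def by blast
qed

text \<open>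
  The contexts of a word depend only on which pairs of states it connects, and a finite graph
  has finitely many sets of pairs of states.
\<close>

lemma sofic_finite_contexts:
  assumes "sofic_shift X" shows "finite (range (contexts X))"
proof -
  obtain E :: "(nat \<times> 'a \<times> nat) set" where E: "finite E"
    "X = {x. \<exists>q :: int \<Rightarrow> nat. \<forall>i. (q i, x i, q (i + 1)) \<in> E}"
    using assms unfolding sofic_shift_def by (elim exE conjE)
  have L: "u \<in> language X \<longleftrightarrow> (\<exists>s t. carries E u s t)" for u
  proof
    assume "u \<in> language X"
    then obtain x i n where "x \<in> X" "u = block x i n" unfolding language_def by blast
    then obtain q where "\<forall>i. (q i, x i, q (i + 1)) \<in> E" "block x i (length u) = u"
      unfolding E(2) by auto
    then have "carries E u (q i) (q (i + int (length u)))" unfolding carries_def by blast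
    then show "\<exists>s t. carries E u s t" by blast
  next
    assume "\<exists>s t. carries E u s t"
    then obtain q x i where *: "\<forall>k. (q k, x k, q (k + 1)) \<in> E" "block x i (length u) = u"
      unfolding carries_def by blast
    then have "x \<in> X" unfolding E(2) by blast
    then show "u \<in> language X" using block_in_language[of x X i "length u"] *(2) by simp
  qed
  define R where "R u = {(s, t). carries E u s t}" for u
  define h where "h S = {(a, b). \<exists>s s' t t'. carries E a s s' \<and> (s', t) \<in> S \<and> carries E b t t'}" for S
  have "contexts X u = h (R u)" for u
    unfolding contexts_def h_def R_def L carries_append by auto
  moreover have "R u \<in> Pow (fst ` E \<times> fst ` E)" for u
  proof -
    have "s \<in> fst ` E \<and> t \<in> fst ` E" if c: "carries E u s t" for s t
    proof -
      obtain q x i where *: "\<forall>k. (q k, x k, q (k + 1)) \<in> E" "q i = s" "q (i + int (length u)) = t"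
        using c unfolding carries_def by blast
      have "q k \<in> fst ` E" for k using image_eqI[OF _ *(1)[rule_format, of k], of _ fst] by simp
      then show ?thesis using *(2,3) by blast
    qed
    then show ?thesis unfolding R_def by blast
  qed
  ultimately have "range (contexts X) \<subseteq> h ` Pow (fst ` E \<times> fst ` E)" by auto
  then show ?thesis by (rule finite_subset) (simp add: E(1))
qed

lemma contexts_eq_iff:
  "contexts X u = contexts X u' \<Longrightarrow> a @ u @ b \<in> language X \<longleftrightarrow> a @ u' @ b \<in> language X"
  unfolding contexts_def by blast

text \<open>
  A synchronizing word does for a sofic shift what a long enough word does for a shift of finite
  type: it separates past and future.
\<close>

definition synchronizing :: "(int \<Rightarrow> 'a) set \<Rightarrow> 'a list \<Rightarrow> bool" where
  "synchronizing X m \<longleftrightarrow> m \<in> language X \<and>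
     (\<forall>a b. a @ m \<in> language X \<longrightarrow> m @ b \<in> language X \<longrightarrow> a @ m @ b \<in> language X)"

lemma synchronizingD:
  "synchronizing X m \<Longrightarrow> a @ m \<in> language X \<Longrightarrow> m @ b \<in> language X \<Longrightarrow> a @ m @ b \<in> language X"
  unfolding synchronizing_def by simp

text \<open>
  There are finitely many follower sets, so some word \<open>m\<close> has a minimal one. Putting letters
  in front of a word can only shrink its follower set, hence leaves that of \<open>m\<close> unchanged.
\<close>

lemma synchronizing_exists:
  assumes fin: "finite (range (contexts X))" and "X \<noteq> {}"
  obtains m where "synchronizing X m"
proof -
  define F where "F u = {b. u @ b \<in> language X}" for u
  have "F u = (\<lambda>C. {b. ([], b) \<in> C}) (contexts X u)" for u
    unfolding F_def contexts_def by simp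
  then have "F ` language X \<subseteq> (\<lambda>C. {b. ([], b) \<in> C}) ` range (contexts X)" by blast
  then have "finite (F ` language X)" using fin finite_surj by blast
  moreover have "F ` language X \<noteq> {}" using assms(2) block_in_language by fastforce
  ultimately obtain m where m: "m \<in> language X"
    and min: "\<And>u. u \<in> language X \<Longrightarrow> F u \<subseteq> F m \<Longrightarrow> F u = F m"
    using finite_has_minimal[of "F ` language X"] by (auto simp: image_iff)
  have "a @ m @ b \<in> language X" if "a @ m \<in> language X" "m @ b \<in> language X" for a b
  proof -
    have "F (a @ m) \<subseteq> F m" unfolding F_def using language_suffix[of a] by auto
    then have "F (a @ m) = F m" using min that(1) by blast
    then show ?thesis using that(2) unfolding F_def by auto
  qed
  then show ?thesis using m by (intro that[of m]) (simp add: synchronizing_def)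
qed

lemma irreducible_shiftD:
  assumes "irreducible_shift X" "u \<in> language X" "v \<in> language X"
  obtains w where "u @ w @ v \<in> language X"
  using assms unfolding irreducible_shift_def by blast

text \<open>
  The length of a shortest connecting word depends only on the contexts of the two words, so it
  takes finitely many values.
\<close>

lemma bounded_connectors:
  assumes fin: "finite (range (contexts X))" and irr: "irreducible_shift X"
  obtains K where "\<And>u v. u \<in> language X \<Longrightarrow> v \<in> language X \<Longrightarrow>
    \<exists>w. length w \<le> K \<and> u @ w @ v \<in> language X"
proof -
  define P where "P c d n \<longleftrightarrow> (\<exists>u v w. contexts X u = c \<and> contexts X v = d \<and> length w = n \<and>
    u @ w @ v \<in> language X)" for c d n
  define K where "K = Max ((\<lambda>(c, d). LEAST n. P c d n) ` (range (contexts X) \<times> range (contexts X)))"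
  have "\<exists>w. length w \<le> K \<and> u @ w @ v \<in> language X" if uv: "u \<in> language X" "v \<in> language X" for u v
  proof -
    let ?n = "LEAST n. P (contexts X u) (contexts X v) n"
    obtain w where "u @ w @ v \<in> language X"
      using irreducible_shiftD[OF irr uv] .
    then have "P (contexts X u) (contexts X v) (length w)" unfolding P_def by blast
    then have "P (contexts X u) (contexts X v) ?n" by (rule LeastI)
    then obtain u' v' w' where w': "contexts X u' = contexts X u" "contexts X v' = contexts X v"
      "length w' = ?n" "u' @ w' @ v' \<in> language X" unfolding P_def by auto
    have "u @ w' @ v' \<in> language X"
      using contexts_eq_iff[OF w'(1), of "[]" "w' @ v'"] w'(4) by simp
    then have "u @ w' @ v \<in> language X"
      using contexts_eq_iff[OF w'(2), of "u @ w'" "[]"] by simp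
    moreover have "?n \<le> K"
      unfolding K_def
    proof (rule Max_ge)
      show "?n \<in> (\<lambda>(c, d). LEAST n. P c d n) ` (range (contexts X) \<times> range (contexts X))"
        by (rule image_eqI[of _ _ "(contexts X u, contexts X v)"]) simp_all
    qed (use fin in simp)
    ultimately show ?thesis using w'(3) by (intro exI[of _ w']) simp
  qed
  then show ?thesis by (rule that[of K])
qed

lemma language_sub_block:
  assumes "block x i n \<in> language X" "i \<le> j" "j + int k \<le> i + int n"
  shows "block x j k \<in> language X"
proof -
  define a where "a = nat (j - i)"
  define b where "b = n - (a + k)"
  have n: "n = a + (k + b)" and j: "j = i + int a" using assms(2,3) unfolding a_def b_def by auto
  show ?thesis using assms(1) unfolding n j block_append by (rule language_factor)
qed

lemma replace_word:
  assumes "shift_space X" "x \<in> X" "block x s n = u" "length u' = n" "contexts X u' = contexts X u"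
  shows "(\<lambda>i. if s \<le> i \<and> i < s + int n then u' ! nat (i - s) else x i) \<in> X" (is "?x \<in> X")
proof (rule shift_space_languageI[OF assms(1)])
  fix N
  define M where "M = N + nat \<bar>s\<bar> + n"
  define a where "a = nat (s + int M)"
  define b where "b = 2 * M + 1 - (a + n)"
  have M: "2 * M + 1 = a + (n + b)" and s: "- int M + int a = s"
    unfolding M_def a_def b_def by auto
  have "block x (- int M) (2 * M + 1) \<in> language X" using assms(2) block_in_language by blast
  then have "block x (- int M) a @ u @ block x (s + int n) b \<in> language X"
    using assms(3) unfolding M block_append s by simp
  then have "block x (- int M) a @ u' @ block x (s + int n) b \<in> language X"
    using contexts_eq_iff[OF assms(5)] by blast
  moreover have "block ?x (- int M) a = block x (- int M) a"
    unfolding block_eq_iff using s by auto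
  moreover have "block ?x s n = u'" by (rule block_eq_listI) (use assms(4) in auto)
  moreover have "block ?x (s + int n) b = block x (s + int n) b"
    unfolding block_eq_iff by auto
  ultimately have "block ?x (- int M) (2 * M + 1) \<in> language X"
    unfolding M block_append s by simp
  then show "block ?x (- int N) (2 * N + 1) \<in> language X"
    by (rule language_sub_block) (auto simp: M_def)
qed

text \<open>
  Irreducibility gives a loop \<open>m a u b m\<close>; because \<open>m\<close> is synchronizing, \<open>m a u b\<close> can be
  repeated forever.
\<close>

lemma periodic_point_through:
  assumes "shift_space X" "irreducible_shift X" "synchronizing X m" "u \<in> language X" "u \<noteq> []"
  obtains x s p where "x \<in> X" "length u \<le> p" "\<And>i. x (i + int p) = x i" "block x s (length u) = u"
proof -
  have m: "m \<in> language X" using assms(3) unfolding synchronizing_def by blast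
  obtain a where a: "m @ a @ u \<in> language X"
    using irreducible_shiftD[OF assms(2) m assms(4)] .
  obtain b where b: "(m @ a @ u) @ b @ m \<in> language X"
    using irreducible_shiftD[OF assms(2) a m] .
  define c where "c = m @ a @ u @ b"
  define p where "p = length c"
  define x where "x i = c ! nat (i mod int p)" for i
  have p: "p > 0" using assms(5) unfolding p_def c_def by simp
  have powers: "concat (replicate k c) @ m \<in> language X" for k
  proof (induction k)
    case (Suc k)
    have "concat (replicate k c) @ m @ (a @ u @ b @ m) \<in> language X"
      by (rule synchronizingD[OF assms(3) Suc]) (use b in simp)
    moreover have "concat (replicate (Suc k) c) = concat (replicate k c) @ c"
      by (simp flip: replicate_append_same)
    ultimately show ?case by (simp add: c_def)
  qed (use m in simp)
  have blk: "block x (int p * j) (p * k) = concat (replicate k c)" for j k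
  proof (induction k arbitrary: j)
    case (Suc k)
    have "block x (int p * j) p = c"
    proof (rule block_eq_listI)
      fix l assume "l < p"
      then have "(int p * j + int l) mod int p = int l" by simp
      then show "x (int p * j + int l) = c ! l" unfolding x_def by simp
    qed (simp add: p_def)
    then show ?case using Suc[of "j + 1"] by (simp add: block_append algebra_simps)
  qed (simp add: block_def)
  have "x \<in> X"
  proof (rule shift_space_languageI[OF assms(1)])
    fix N
    have "block x (int p * (- int N)) (p * (2 * N + 1)) \<in> language X"
      unfolding blk using powers language_prefix by blast
    then show "block x (- int N) (2 * N + 1) \<in> language X"
    proof (rule language_sub_block)
      show "int p * (- int N) \<le> - int N" using p by (simp add: mult_le_cancel_right1)
      have "1 * (int N + 1) \<le> int p * (int N + 1)" by (rule mult_right_mono) (use p in auto)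
      then show "- int N + int (2 * N + 1) \<le> int p * (- int N) + int (p * (2 * N + 1))"
        by (simp add: algebra_simps)
    qed
  qed
  moreover have "length u \<le> p" unfolding p_def c_def by simp
  moreover have "x (i + int p) = x i" for i unfolding x_def by simp
  moreover have "block x (int (length (m @ a))) (length u) = u"
  proof (rule block_eq_listI)
    fix k assume k: "k < length u"
    then have "(int (length (m @ a)) + int k) mod int p = int (length (m @ a)) + int k"
      unfolding p_def c_def by (intro mod_pos_pos_trivial) auto
    moreover have "nat (int (length (m @ a)) + int k) = length (m @ a) + k" by simp
    ultimately show "x (int (length (m @ a)) + int k) = u ! k"
      using k unfolding x_def c_def by (simp add: nth_append)
  qed simp
  ultimately show ?thesis by (rule that[of x p "int (length (m @ a))"])
qed

section \<open>Factor codes are sliding block codes\<close>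

text \<open>
  The theorem of Curtis, Hedlund and Lyndon at coordinate \<open>0\<close>: by continuity the symbol
  \<open>\<pi> x 0\<close> is determined by a window of \<open>x\<close>, and by compactness the radius can be chosen
  independently of \<open>x\<close>.
\<close>

lemma factor_code_radius:
  assumes "factor_code X Y \<pi>"
  shows "\<exists>r. \<forall>x\<in>X. \<forall>z\<in>X. window r x = window r z \<longrightarrow> \<pi> x 0 = \<pi> z 0"
proof -
  have X: "shift_space X" and cont: "continuous_on X \<pi>"
    using assms unfolding factor_code_def by simp_all
  have ex: "\<exists>N. \<forall>z\<in>X. window N z = window N x \<longrightarrow> \<pi> z 0 = \<pi> x 0" if x: "x \<in> X" for x
  proof -
    have "open {y. window 0 y 0 = \<pi> x 0}" by (rule open_window_pred)
    then obtain A where A: "open A" "A \<inter> X = \<pi> -` {y. window 0 y 0 = \<pi> x 0} \<inter> X"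
      using cont unfolding continuous_on_open_invariant by blast
    have "x \<in> A" using A(2) x by (auto simp: window_def)
    then obtain N where "\<And>z. window N z = window N x \<Longrightarrow> z \<in> A"
      using open_contains_window[OF A(1)] by blast
    then have "\<forall>z\<in>X. window N z = window N x \<longrightarrow> \<pi> z 0 = \<pi> x 0"
      using A(2) by (auto simp: window_def)
    then show ?thesis by blast
  qed
  then obtain N where N: "\<And>x z. x \<in> X \<Longrightarrow> z \<in> X \<Longrightarrow> window (N x) z = window (N x) x \<Longrightarrow> \<pi> z 0 = \<pi> x 0"
    by metis
  define U where "U x = {z. window (N x) z = window (N x) x}" for x
  have "open (U x)" for x unfolding U_def by (rule open_window_pred)
  moreover have "X \<subseteq> (\<Union>x\<in>X. U x)" unfolding U_def by blast
  ultimately obtain F where F: "F \<subseteq> X" "finite F" "X \<subseteq> (\<Union>x\<in>F. U x)"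
    using compactE_image[OF shift_space_compact[OF X], of X U] by blast
  define r where "r = Max (N ` F)"
  have "\<pi> x 0 = \<pi> z 0" if xz: "x \<in> X" "z \<in> X" "window r x = window r z" for x z
  proof -
    obtain f where f: "f \<in> F" "x \<in> U f" using F(3) xz(1) by blast
    have "N f \<le> r" unfolding r_def using F(2) f(1) by simp
    then have "window (N f) x = window (N f) z" using window_mono[OF xz(3)] by simp
    then have "\<pi> z 0 = \<pi> f 0" "\<pi> x 0 = \<pi> f 0"
      using N[of f z] N[of f x] f F(1) xz unfolding U_def by auto
    then show ?thesis by simp
  qed
  then show ?thesis by blast
qed

text \<open>
  The coding radius \<open>r\<close> and the synchronizing word \<open>m\<close> are parameters so that definitions
  can refer to them; they exist by \<open>factor_code_radius\<close> and \<open>synchronizing_exists\<close>.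
\<close>

locale sofic_code =
  fixes X :: "(int \<Rightarrow> 'a::discrete_topology) set"
    and Y :: "(int \<Rightarrow> 'b::discrete_topology) set"
    and \<pi> :: "(int \<Rightarrow> 'a) \<Rightarrow> (int \<Rightarrow> 'b)"
    and r :: nat and m :: "'a list"
  assumes sofic: "sofic_shift X" and irreducible: "irreducible_shift X"
    and code: "factor_code X Y \<pi>" and finite_to_one: "finite_to_one X Y \<pi>"
    and radius: "\<And>x z. x \<in> X \<Longrightarrow> z \<in> X \<Longrightarrow> window r x = window r z \<Longrightarrow> \<pi> x 0 = \<pi> z 0"
    and sync: "synchronizing X m"
begin

definition fibre :: "(int \<Rightarrow> 'b) \<Rightarrow> (int \<Rightarrow> 'a) set" where
  "fibre y = {x \<in> X. \<pi> x = y}"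

lemma shift_X: "shift_space X" and shift_Y: "shift_space Y"
  using code unfolding factor_code_def by simp_all

lemma image_in: "x \<in> X \<Longrightarrow> \<pi> x \<in> Y"
  using code unfolding factor_code_def by blast

lemma shift_in: "x \<in> X \<Longrightarrow> shift_by t x \<in> X"
  by (rule shift_space_shift_by[OF shift_X])

lemma code_shift_by: "x \<in> X \<Longrightarrow> \<pi> (shift_by t x) = shift_by t (\<pi> x)"
proof (induction t arbitrary: x rule: int_induct[of _ 0])
  have *: "\<pi> (shift_by 1 x) = shift_by 1 (\<pi> x)" if "x \<in> X" for x
    using code that unfolding factor_code_def shift_by_1 by blast
  {
    case (step1 i)
    then show ?case using *[OF shift_in[OF step1.prems, of i]] by (simp add: add.commute)
  next
    case (step2 i)
    have "shift_by 1 (\<pi> (shift_by (i - 1) x)) = \<pi> (shift_by 1 (shift_by (i - 1) x))"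
      by (rule *[OF shift_in[OF step2.prems], symmetric])
    also have "\<dots> = shift_by i (\<pi> x)" using step2 by simp
    finally have "shift_by (-1) (shift_by 1 (\<pi> (shift_by (i - 1) x))) = shift_by (-1) (shift_by i (\<pi> x))"
      by simp
    then show ?case by (simp add: add.commute)
  }
qed simp

lemma local_code:
  assumes "x \<in> X" "z \<in> X" "\<And>j. \<bar>j - i\<bar> \<le> int r \<Longrightarrow> x j = z j"
  shows "\<pi> x i = \<pi> z i"
proof -
  have "window r (shift_by i x) = window r (shift_by i z)"
    unfolding window_eq_iff shift_by_apply using assms(3) by simp
  then have "\<pi> (shift_by i x) 0 = \<pi> (shift_by i z) 0"
    using radius assms(1,2) shift_in by blast
  then show ?thesis using assms(1,2) by (simp add: code_shift_by shift_by_apply)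
qed

lemma finite_fibre: "y \<in> Y \<Longrightarrow> finite (fibre y)"
  using finite_to_one unfolding finite_to_one_def fibre_def by blast

lemma fibre_shift_by: "fibre (shift_by t y) = shift_by t ` fibre y"
proof
  show "shift_by t ` fibre y \<subseteq> fibre (shift_by t y)"
    unfolding fibre_def by (auto simp: shift_in code_shift_by)
  show "fibre (shift_by t y) \<subseteq> shift_by t ` fibre y"
  proof
    fix x assume "x \<in> fibre (shift_by t y)"
    then have "shift_by (- t) x \<in> fibre y" unfolding fibre_def by (auto simp: shift_in code_shift_by)
    then show "x \<in> shift_by t ` fibre y" by (rule rev_image_eqI) simp
  qed
qed

lemma card_fibre_shift_by: "card (fibre (shift_by t y)) = card (fibre y)"
  unfolding fibre_shift_by
  by (rule card_image, rule inj_on_inverseI[of _ "shift_by (- t)"]) simp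

lemma finite_contexts: "finite (range (contexts X))"
  by (rule sofic_finite_contexts[OF sofic])

section \<open>Absence of diamonds\<close>

text \<open>
  The block map induced by the code: a word of length \<open>n\<close> determines the image on its middle
  \<open>n - 2 * r\<close> coordinates. The choice of the point is irrelevant by \<open>word_image_block\<close>.
\<close>

definition word_image :: "'a list \<Rightarrow> 'b list" where
  "word_image u = block (\<pi> (SOME x. x \<in> X \<and> block x 0 (length u) = u)) (int r) (length u - 2 * r)"

lemma word_image_block:
  assumes "x \<in> X" shows "word_image (block x i n) = block (\<pi> x) (i + int r) (n - 2 * r)"
proof -
  let ?u = "block x i n"
  let ?z = "SOME z. z \<in> X \<and> block z 0 (length ?u) = ?u"
  have "shift_by i x \<in> X \<and> block (shift_by i x) 0 (length ?u) = ?u"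
    using shift_in[OF assms] by (simp add: block_shift_by)
  then have z: "?z \<in> X \<and> block ?z 0 (length ?u) = ?u"
    by (rule someI[of "\<lambda>z. z \<in> X \<and> block z 0 (length ?u) = ?u"])
  have eq: "?z (int k) = x (i + int k)" if "k < n" for k
    using z that by (simp add: block_eq_iff)
  have "\<pi> ?z (int r + int k) = \<pi> (shift_by i x) (int r + int k)" if k: "k < n - 2 * r" for k
  proof (rule local_code)
    fix j assume "\<bar>j - (int r + int k)\<bar> \<le> int r"
    then have "0 \<le> j" "nat j < n" using k by auto
    then show "?z j = shift_by i x j" using eq[of "nat j"] by (simp add: shift_by_apply add.commute)
  qed (use z shift_in[OF assms] in auto)
  then show ?thesis unfolding word_image_def
    using assms by (auto simp: block_eq_iff code_shift_by shift_by_apply algebra_simps)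
qed

text \<open>
  Two different words with the same contexts, the same image and the same ends form a diamond.
  Take a periodic point through \<open>u\<close> and replace \<open>u\<close> by \<open>u'\<close> in a single period. Equal
  contexts keep the result in \<open>X\<close>, and equal ends and images keep its image unchanged. As the
  period can be chosen in infinitely many ways, some fibre would be infinite.
\<close>

lemma no_diamond:
  assumes u: "u \<in> language X" and u': "length u' = length u" "contexts X u' = contexts X u"
    and img: "word_image u = word_image u'"
    and ends: "take (2 * r) u = take (2 * r) u'" "drop (length u - 2 * r) u = drop (length u - 2 * r) u'"
  shows "u = u'"
proof (rule ccontr)
  assume ne: "u \<noteq> u'"
  let ?n = "length u"
  have "u \<noteq> []" using ne u' by auto
  then obtain x s p where x: "x \<in> X" "?n \<le> p" "\<And>i. x (i + int p) = x i" "block x s ?n = u"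
    using periodic_point_through[OF shift_X irreducible sync u] by metis
  define z where "z i = (if s \<le> i \<and> i < s + int ?n then u' ! nat (i - s) else x i)" for i
  have z: "z \<in> X" unfolding z_def using replace_word[OF shift_X x(1,4) u'] .
  have zu': "block z s ?n = u'" by (rule block_eq_listI) (simp_all add: z_def u')
  have xu: "x (s + int k) = u ! k" if "k < ?n" for k using nth_block[of k ?n x s] x(4) that by simp
  have zu: "z (s + int k) = u' ! k" if "k < ?n" for k using that by (simp add: z_def)
  have img_eq: "\<pi> z = \<pi> x"
  proof
    fix i
    show "\<pi> z i = \<pi> x i"
    proof (cases "s + int r \<le> i \<and> i + int r < s + int ?n")
      case True
      have "block (\<pi> z) (s + int r) (?n - 2 * r) = block (\<pi> x) (s + int r) (?n - 2 * r)"
        using word_image_block[OF z, of s ?n] word_image_block[OF x(1), of s ?n] img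
        unfolding zu' x(4) by simp
      then have *: "\<pi> z (s + int r + int k) = \<pi> x (s + int r + int k)" if "k < ?n - 2 * r" for k
        using that by (simp add: block_eq_iff)
      show ?thesis using *[of "nat (i - s - int r)"] True by auto
    next
      case False
      show ?thesis
      proof (rule local_code[OF z x(1)])
        fix j assume j: "\<bar>j - i\<bar> \<le> int r"
        show "z j = x j"
        proof (cases "s \<le> j \<and> j < s + int ?n")
          case True
          define k where "k = nat (j - s)"
          have k: "k < ?n" "j = s + int k" using True unfolding k_def by auto
          \<comment> \<open>Here the coding window around \<open>i\<close> leaves the replaced word, so what it sees of
            that word lies in one of the common ends.\<close>
          have "k < 2 * r \<or> ?n - 2 * r \<le> k" using False j k by linarith
          then have "u' ! k = u ! k"
          proof
            assume "k < 2 * r"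
            then show ?thesis using ends(1) k(1) u'(1) by (metis nth_take)
          next
            assume *: "?n - 2 * r \<le> k"
            have "drop (?n - 2 * r) u ! (k - (?n - 2 * r)) = drop (?n - 2 * r) u' ! (k - (?n - 2 * r))"
              using ends(2) by simp
            then show ?thesis using * k(1) u'(1) by simp
          qed
          then show ?thesis using xu zu k by simp
        next
          case outside: False
          show ?thesis unfolding z_def by (simp only: outside if_False)
        qed
      qed
    qed
  qed
  have per: "shift_by (- (int p * int j)) x = x" for j
  proof (induction j)
    case (Suc j)
    have "shift_by (- int p) x = x"
      using x(3)[of "_ - int p"] by (auto simp: shift_by_def)
    then have "shift_by (- (int p * int j)) (shift_by (- int p) x) = x" using Suc by simp
    then show ?case by (simp add: algebra_simps)
  qed simp
  define f where "f j = shift_by (- (int p * int j)) z" for j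
  have "f j \<in> fibre (\<pi> x)" for j
    using z img_eq code_shift_by[OF x(1), of "- (int p * int j)"] per[of j]
    unfolding f_def fibre_def by (simp add: shift_in code_shift_by)
  moreover have "inj f"
  proof (rule injI, rule ccontr)
    fix j l assume jl: "f j = f l" "j \<noteq> l"
    obtain k where k: "k < ?n" "u ! k \<noteq> u' ! k" using ne u'(1) by (metis nth_equalityI)
    have "z (s + int k) = f j (s + int k + int p * int j)" unfolding f_def shift_by_def by simp
    also have "\<dots> = z (s + int k + int p * (int j - int l))"
      unfolding jl(1) unfolding f_def shift_by_def by (simp add: algebra_simps)
    also have "\<dots> = x (s + int k + int p * (int j - int l))"
    proof -
      have "\<bar>int j - int l\<bar> \<ge> 1" using jl(2) by simp
      then have "\<bar>int p * (int j - int l)\<bar> \<ge> int p"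
        by (simp add: abs_mult mult_le_cancel_left1)
      \<comment> \<open>A nonzero multiple of the period moves a coordinate of the replaced word out of it,
        since the word is no longer than a period.\<close>
      then have "\<not> (s \<le> s + int k + int p * (int j - int l) \<and> s + int k + int p * (int j - int l) < s + int ?n)"
        using x(2) k(1) by linarith
      then show ?thesis unfolding z_def by (simp only: if_False)
    qed
    also have "\<dots> = x (s + int k)"
    proof -
      have pp: "x (i + int p * int q) = x i" for i q
      proof (induction q)
        case (Suc q)
        then show ?case using x(3)[of "i + int p * int q"] by (simp add: algebra_simps)
      qed simp
      show ?thesis
      proof (cases "l \<le> j")
        case True
        then show ?thesis using pp[of "s + int k" "j - l"] by (simp add: of_nat_diff)
      next
        case False
        then show ?thesis using pp[of "s + int k + int p * (int j - int l)" "l - j"]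
          by (simp add: of_nat_diff algebra_simps)
      qed
    qed
    finally show False using xu zu k by simp
  qed
  ultimately show False
    using finite_fibre[OF image_in[OF x(1)]] by (meson finite_subset image_subsetI infinite_UNIV_nat finite_imageD)
qed

abbreviation "words_X n \<equiv> {u \<in> language X. length u = n}"
abbreviation "words_Y n \<equiv> {u \<in> language Y. length u = n}"

lemma word_image_in_language:
  assumes "u \<in> language X" shows "word_image u \<in> words_Y (length u - 2 * r)"
proof -
  obtain x i n where "x \<in> X" "u = block x i n" using assms unfolding language_def by blast
  then show ?thesis using word_image_block[of x i n] block_in_language[OF image_in] by auto
qed

text \<open>
  By \<open>no_diamond\<close> a word of \<open>X\<close> is determined by its image up to its contexts and its two
  ends of length \<open>2 * r\<close>, for which there are boundedly many possibilities. This is the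
  counting form of the fact that a finite-to-one code does not lower entropy.
\<close>

lemma card_words_le_card_image_words:
  obtains C where "\<And>n. n \<ge> 2 * r \<Longrightarrow> card (words_X n) \<le> C * card (words_Y (n - 2 * r))"
proof -
  let ?R = "range (contexts X)" and ?W = "words_X (2 * r)"
  have "card (words_X n) \<le> card ?R * card ?W * card ?W * card (words_Y (n - 2 * r))" if n: "n \<ge> 2 * r" for n
  proof -
    define h where "h u = (((contexts X u, take (2 * r) u), drop (n - 2 * r) u), word_image u)" for u
    have "card (words_X n) \<le> card (((?R \<times> ?W) \<times> ?W) \<times> words_Y (n - 2 * r))"
    proof (rule card_inj_on_le[of h])
      show "inj_on h (words_X n)"
        by (rule inj_onI, rule no_diamond) (auto simp: h_def)
      have "take (2 * r) u \<in> language X" "drop k u \<in> language X" if "u \<in> language X" for u k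
        using that language_prefix[of "take (2 * r) u" "drop (2 * r) u"]
          language_suffix[of "take k u" "drop k u"] by simp_all
      then show "h ` words_X n \<subseteq> ((?R \<times> ?W) \<times> ?W) \<times> words_Y (n - 2 * r)"
        using n word_image_in_language by (auto simp: h_def)
      show "finite (((?R \<times> ?W) \<times> ?W) \<times> words_Y (n - 2 * r))"
        by (intro finite_SigmaI finite_contexts finite_language_length[OF shift_X] finite_language_length[OF shift_Y])
    qed
    then show ?thesis by (simp add: card_cartesian_product)
  qed
  then show ?thesis by (rule that)
qed

section \<open>Preimages of transitive points\<close>

text \<open>
  Suppose \<open>x\<close> omits \<open>m\<close>. Since the image of \<open>x\<close> contains all words of \<open>Y\<close>, \<open>x\<close>
  contains, up to a constant, as many words of length \<open>n\<close> as \<open>X\<close>: it contains at least as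
  many as \<open>Y\<close> has words of the length of their images, and \<open>card_words_le_card_image_words\<close>
  applies. But inserting \<open>m\<close>, with bounded connecting words, at one of \<open>n + 1\<close> positions of
  a word of \<open>x\<close> shows that \<open>X\<close> has, up to a constant, \<open>n + 1\<close> times as many words as
  \<open>x\<close>. This replaces the argument that a proper subshift of \<open>X\<close> has smaller entropy.
\<close>

lemma transitive_preimage_sees_sync:
  assumes x: "x \<in> X" and trans: "\<And>w. w \<in> language Y \<Longrightarrow> \<exists>i. block (\<pi> x) i (length w) = w"
  shows "\<exists>i. block x i (length m) = m"
proof (rule ccontr)
  assume no: "\<nexists>i. block x i (length m) = m"
  then have "m \<noteq> []" by (auto simp: block_def)
  define A where "A n = range (\<lambda>i. block x i n)" for n
  have A_sub: "A n \<subseteq> words_X n" for n unfolding A_def using block_in_language[OF x] by auto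
  have fin_X: "finite (words_X n)" for n by (rule finite_language_length[OF shift_X])
  have fin_A: "finite (A n)" for n by (rule finite_subset[OF A_sub fin_X])
  have Y_le_A: "card (words_Y k) \<le> card (A (k + 2 * r))" for k
  proof (rule surj_card_le[OF fin_A, of _ word_image])
    show "words_Y k \<subseteq> word_image ` A (k + 2 * r)"
    proof
      fix w assume w: "w \<in> words_Y k"
      then obtain i where "block (\<pi> x) i k = w" using trans[of w] by auto
      then have "w = word_image (block x (i - int r) (k + 2 * r))" using word_image_block[OF x] by simp
      then show "w \<in> word_image ` A (k + 2 * r)" unfolding A_def by blast
    qed
  qed
  obtain C where C: "\<And>n. n \<ge> 2 * r \<Longrightarrow> card (words_X n) \<le> C * card (words_Y (n - 2 * r))"
    using card_words_le_card_image_words by blast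
  obtain K where K: "\<And>u v. u \<in> language X \<Longrightarrow> v \<in> language X \<Longrightarrow>
    \<exists>w. length w \<le> K \<and> u @ w @ v \<in> language X"
    using bounded_connectors[OF finite_contexts irreducible] by blast
  have m: "m \<in> language X" using sync unfolding synchronizing_def by blast
  define l where "l = 2 * K + length m"
  have insertion: "(n + 1) * card (A n) \<le> card (words_X (n + l)) * ((K + 1) * (K + 1) * (K + length m))" for n
  proof -
    have ex: "\<exists>a b e. length a \<le> K \<and> length b \<le> K \<and>
        take i z @ a @ m @ b @ drop i z @ e \<in> words_X (n + l)" if z: "z \<in> A n" and "i \<le> n" for z i
    proof -
      have len: "length z = n" and "z \<in> language X" using subsetD[OF A_sub z] by simp_all
      then have L: "take i z \<in> language X" "drop i z \<in> language X"
        using language_prefix[of "take i z" "drop i z"] language_suffix[of "take i z" "drop i z"] by simp_all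
      obtain a where a: "length a \<le> K" "take i z @ a @ m \<in> language X" using K[OF L(1) m] by blast
      obtain b where b: "length b \<le> K" "m @ b @ drop i z \<in> language X" using K[OF m L(2)] by blast
      have "(take i z @ a) @ m @ (b @ drop i z) \<in> language X"
        by (rule synchronizingD[OF sync]) (use a b in simp_all)
      then obtain e where "length e = l - (length a + length m + length b)"
        "((take i z @ a) @ m @ (b @ drop i z)) @ e \<in> language X"
        using shift_space_language_extend[OF shift_X] by blast
      then have "take i z @ a @ m @ b @ drop i z @ e \<in> words_X (n + l)"
        using a(1) b(1) len \<open>i \<le> n\<close> by (simp add: l_def)
      then show ?thesis using a(1) b(1) by blast
    qed
    define P where "P z i = (\<lambda>(a, b, e). length a \<le> K \<and> length b \<le> K \<and>
        take i z @ a @ m @ b @ drop i z @ e \<in> words_X (n + l))" for z i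
    define c where "c z i = (SOME t. P z i t)" for z i
    define a where "a z i = fst (c z i)" for z i
    define b where "b z i = fst (snd (c z i))" for z i
    define e where "e z i = snd (snd (c z i))" for z i
    have abe: "length (a z i) \<le> K \<and> length (b z i) \<le> K \<and>
        take i z @ a z i @ m @ b z i @ drop i z @ e z i \<in> words_X (n + l)" if "z \<in> A n" "i \<le> n" for z i
    proof -
      have "\<exists>t. P z i t" using ex[OF that] unfolding P_def by simp
      then have "P z i (c z i)" unfolding c_def by (rule someI_ex)
      then show ?thesis unfolding P_def a_def b_def e_def by (simp add: case_prod_beta)
    qed
    define G where "G z i = take i z @ a z i @ m @ b z i @ drop i z @ e z i" for z i
    \<comment> \<open>The first occurrence of \<open>m\<close> in \<open>G z i\<close> locates the position \<open>i\<close> of the insertion up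
      to a bounded error, because \<open>z\<close> itself omits \<open>m\<close>.\<close>
    define j0 where "j0 w = (LEAST j. take (length m) (drop j w) = m)" for w
    have len: "length z = n" if "z \<in> A n" for z using subsetD[OF A_sub that] by simp
    have occ: "take (length m) (drop (i + length (a z i)) (G z i)) = m" if "z \<in> A n" "i \<le> n" for z i
      using len[OF that(1)] that(2) unfolding G_def by simp
    have j0_le: "j0 (G z i) \<le> i + K" if "z \<in> A n" "i \<le> n" for z i
    proof -
      have "j0 (G z i) \<le> i + length (a z i)" unfolding j0_def by (rule Least_le) (rule occ[OF that])
      then show ?thesis using abe[OF that] by linarith
    qed
    \<comment> \<open>An occurrence of \<open>m\<close> inside the prefix \<open>take i z\<close> would be an occurrence in \<open>x\<close>.\<close>
    have j0_ge: "i < j0 (G z i) + length m" if zi: "z \<in> A n" "i \<le> n" for z i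
    proof (rule ccontr)
      assume neg: "\<not> i < j0 (G z i) + length m"
      let ?j = "j0 (G z i)"
      have *: "take (length m) (drop ?j (G z i)) = m" 
        unfolding j0_def using LeastI[of "\<lambda>j. take (length m) (drop j (G z i)) = m", OF occ[OF zi]] .
      obtain s where s: "z = block x s n" using zi(1) unfolding A_def by blast
      have "block x (s + int ?j) (length m) = m"
      proof (rule block_eq_listI)
        fix k assume k: "k < length m"
        have "m ! k = take (length m) (drop ?j (G z i)) ! k" unfolding * ..
        also have "\<dots> = drop ?j (G z i) ! k" by (rule nth_take[OF k])
        also have "\<dots> = G z i ! (?j + k)"
        proof (rule nth_drop)
          have "i \<le> length (G z i)" using zi(2) len[OF zi(1)] by (simp add: G_def)
          then show "?j \<le> length (G z i)" using neg by linarith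
        qed
        also have "\<dots> = z ! (?j + k)"
        proof -
          have "?j + k < i" using k neg by linarith
          then show ?thesis using zi(2) len[OF zi(1)] unfolding G_def by (simp add: nth_append)
        qed
        also have "\<dots> = x (s + int ?j + int k)"
          using k neg zi(2) s by (simp add: add.assoc)
        finally show "x (s + int ?j + int k) = m ! k" ..
      qed simp
      then show False using no by blast
    qed
    \<comment> \<open>From this code both \<open>z\<close> and \<open>i\<close> can be recovered. The term \<open>K\<close> keeps the
      natural-number difference from being truncated.\<close>
    define h where "h = (\<lambda>(z, i). (((G z i, length (a z i)), length (b z i)), i + K - j0 (G z i)))"
    have "card (A n \<times> {..n}) \<le> card (((words_X (n + l) \<times> {..K}) \<times> {..K}) \<times> {..<K + length m})"
    proof (rule card_inj_on_le[of h])
      show "inj_on h (A n \<times> {..n})"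
      proof (rule inj_onI)
        fix p p' assume p: "p \<in> A n \<times> {..n}" "p' \<in> A n \<times> {..n}" and hp: "h p = h p'"
        obtain z i z' i' where pz: "p = (z, i)" "p' = (z', i')" by (cases p; cases p') blast
        then have zi: "z \<in> A n" "i \<le> n" "z' \<in> A n" "i' \<le> n" using p by simp_all
        from hp have G: "G z i = G z' i'" and la: "length (a z i) = length (a z' i')"
          and lb: "length (b z i) = length (b z' i')" and "i + K - j0 (G z i) = i' + K - j0 (G z i)"
          unfolding h_def pz by auto
        then have i: "i = i'" using j0_le[of z i] j0_le[of z' i'] zi by simp
        have t: "take i z = take i (G z i)" "drop i z = take (n - i) (drop (i + length (a z i) + length m + length (b z i)) (G z i))"
          if "z \<in> A n" "i \<le> n" for z i using len[OF that(1)] that(2) by (simp_all add: G_def)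
        have 1: "take i z = take i z'"
          unfolding t(1)[OF zi(1,2)] G unfolding i using t(1)[OF zi(3,4)] by (rule sym)
        have 2: "drop i z = drop i z'"
          unfolding t(2)[OF zi(1,2)] G la lb unfolding i using t(2)[OF zi(3,4)] by (rule sym)
        have "z = z'" using arg_cong2[OF 1 2, of append] unfolding append_take_drop_id .
        then show "p = p'" using i by (simp add: pz)
      qed
      show "h ` (A n \<times> {..n}) \<subseteq> ((words_X (n + l) \<times> {..K}) \<times> {..K}) \<times> {..<K + length m}"
      proof (rule image_subsetI)
        fix p assume "p \<in> A n \<times> {..n}"
        then obtain z i where p: "p = (z, i)" "z \<in> A n" "i \<le> n" by auto
        have "length m > 0" using \<open>m \<noteq> []\<close> by simp
        then have "i + K - j0 (G z i) < K + length m" using j0_ge[OF p(2,3)] by arith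
        then show "h p \<in> ((words_X (n + l) \<times> {..K}) \<times> {..K}) \<times> {..<K + length m}"
          using abe[OF p(2,3)] unfolding h_def p(1) G_def by simp
      qed
      show "finite (((words_X (n + l) \<times> {..K}) \<times> {..K}) \<times> {..<K + length m})"
        by (intro finite_SigmaI fin_X) simp_all
    qed
    then show ?thesis by (simp add: card_cartesian_product algebra_simps)
  qed
  have tail: "card (words_X (n + l)) \<le> card (words_X n) * card (words_X l)" for n
  proof -
    have "card (words_X (n + l)) \<le> card (words_X n \<times> words_X l)"
    proof (rule card_inj_on_le[of "\<lambda>u. (take n u, drop n u)"])
      show "inj_on (\<lambda>u. (take n u, drop n u)) (words_X (n + l))"
      proof (rule inj_onI)
        fix u v assume "(take n u, drop n u) = (take n v, drop n v)"
        then have "take n u @ drop n u = take n v @ drop n v" by simp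
        then show "u = v" unfolding append_take_drop_id .
      qed
      have "take n u \<in> language X" "drop n u \<in> language X" if "u \<in> language X" for u
        using that language_prefix[of "take n u" "drop n u"] language_suffix[of "take n u" "drop n u"]
        by simp_all
      then show "(\<lambda>u. (take n u, drop n u)) ` words_X (n + l) \<subseteq> words_X n \<times> words_X l" by auto
    qed (intro finite_SigmaI fin_X)
    then show ?thesis by (simp add: card_cartesian_product)
  qed
  define D where "D = card (words_X l) * ((K + 1) * (K + 1) * (K + length m))"
  define n where "n = C * D + 2 * r"
  have "(n + 1) * card (A n) \<le> card (words_X (n + l)) * ((K + 1) * (K + 1) * (K + length m))"
    by (rule insertion)
  also have "\<dots> \<le> (card (words_X n) * card (words_X l)) * ((K + 1) * (K + 1) * (K + length m))"
    by (rule mult_right_mono[OF tail]) simp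
  also have "\<dots> = card (words_X n) * D" by (simp add: D_def)
  also have "\<dots> \<le> (C * card (words_Y (n - 2 * r))) * D"
    by (rule mult_right_mono[OF C]) (simp_all add: n_def)
  also have "\<dots> \<le> (C * card (A n)) * D"
    using Y_le_A[of "n - 2 * r"] by (intro mult_right_mono mult_left_mono) (simp_all add: n_def)
  finally have "(n + 1) * card (A n) \<le> C * D * card (A n)" by (simp add: ac_simps)
  moreover have "card (A n) > 0" using fin_A by (simp add: card_gt_0_iff A_def)
  ultimately have "n + 1 \<le> C * D" unfolding mult_le_cancel2 by blast
  then show False by (simp add: n_def)
qed

section \<open>Constancy of the degree\<close>

definition sees :: "nat \<Rightarrow> (int \<Rightarrow> 'a) \<Rightarrow> bool" where
  "sees N x \<longleftrightarrow> (\<exists>s. - int N \<le> s \<and> s + int (length m) \<le> int N + 1 \<and> block x s (length m) = m)"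

lemma sees_cong: "window N x = window N z \<Longrightarrow> sees N x \<Longrightarrow> sees N z"
proof -
  assume *: "window N x = window N z" "sees N x"
  then obtain s where s: "- int N \<le> s" "s + int (length m) \<le> int N + 1" "block x s (length m) = m"
    unfolding sees_def by blast
  have "block z s (length m) = block x s (length m)"
    unfolding block_eq_iff
  proof (intro allI impI)
    fix k assume "k < length m"
    then have "\<bar>s + int k\<bar> \<le> int N" using s(1,2) by auto
    then show "z (s + int k) = x (s + int k)" using *(1) unfolding window_eq_iff by simp
  qed
  then show "sees N z" using s unfolding sees_def by auto
qed

lemma sees_mono:
  assumes "sees M x" "M \<le> N" shows "sees N x"
proof -
  obtain s where "- int M \<le> s" "s + int (length m) \<le> int M + 1" "block x s (length m) = m"
    using assms(1) unfolding sees_def by blast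
  then show ?thesis using assms(2) unfolding sees_def by (intro exI[of _ s]) auto
qed

text \<open>
  Points that agree on a window containing \<open>m\<close> can be spliced there, because \<open>m\<close> is
  synchronizing. If the window is at least as wide as the coding window, then the images are
  spliced as well.
\<close>

lemma glue:
  assumes x: "x \<in> X" and z: "z \<in> X" and "r \<le> N"
    and win: "window N (shift_by p x) = window N (shift_by p z)" and sees: "sees N (shift_by p x)"
  defines "g \<equiv> \<lambda>i. if i \<le> p then x i else z i"
  shows "g \<in> X" and "\<And>i. i \<le> p \<Longrightarrow> \<pi> g i = \<pi> x i" and "\<And>i. i > p \<Longrightarrow> \<pi> g i = \<pi> z i"
proof -
  have eq: "x i = z i" if "\<bar>i - p\<bar> \<le> int N" for i
    using win[unfolded window_eq_iff, rule_format, of "i - p"] that by (simp add: shift_by_apply)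
  obtain s where s: "- int N \<le> s" "s + int (length m) \<le> int N + 1" "block x (s + p) (length m) = m"
    using sees unfolding sees_def block_shift_by by blast
  have g_left: "g i = x i" if "i \<le> p + int N" for i using eq[of i] that unfolding g_def by auto
  have g_right: "g i = z i" if "i \<ge> p - int N" for i using eq[of i] that unfolding g_def by auto
  have m_z: "block z (s + p) (length m) = m"
  proof (rule block_eq_listI)
    fix k assume k: "k < length m"
    then have "\<bar>s + p + int k - p\<bar> \<le> int N" using s(1,2) by auto
    then show "z (s + p + int k) = m ! k" using eq[of "s + p + int k"] nth_block[OF k, of x "s + p"] s(3) by simp
  qed simp
  show g: "g \<in> X"
  proof (rule shift_space_languageI[OF shift_X])
    fix L
    define M where "M = L + N + nat \<bar>p\<bar> + length m"
    define a where "a = nat (s + p + int M)"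
    define b where "b = 2 * M + 1 - (a + length m)"
    have M: "2 * M + 1 = a + (length m + b)" and sp: "- int M + int a = s + p"
      using s(1,2) unfolding M_def a_def b_def by auto
    have "block x (- int M) (a + length m) \<in> language X" using block_in_language[OF x] .
    then have 1: "block x (- int M) a @ m \<in> language X" unfolding block_append sp s(3) .
    have "block z (s + p) (length m + b) \<in> language X" using block_in_language[OF z] .
    then have 2: "m @ block z (s + p + int (length m)) b \<in> language X" unfolding block_append m_z .
    have "block g (- int M) a = block x (- int M) a"
      unfolding block_eq_iff using sp s(2) by (intro allI impI g_left) auto
    moreover have "block g (s + p) (length m) = block z (s + p) (length m)"
      unfolding block_eq_iff using s(1) by (intro allI impI g_right) auto
    moreover have "block g (s + p + int (length m)) b = block z (s + p + int (length m)) b"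
      unfolding block_eq_iff using s(1) by (intro allI impI g_right) auto
    ultimately have "block g (- int M) (2 * M + 1) \<in> language X"
      using synchronizingD[OF sync 1 2] unfolding M block_append sp m_z by simp
    then show "block g (- int L) (2 * L + 1) \<in> language X"
      by (rule language_sub_block) (auto simp: M_def)
  qed
  show "\<pi> g i = \<pi> x i" if "i \<le> p" for i
    by (rule local_code[OF g x], rule g_left) (use that \<open>r \<le> N\<close> in auto)
  show "\<pi> g i = \<pi> z i" if "i > p" for i
    by (rule local_code[OF g z], rule g_right) (use that \<open>r \<le> N\<close> in auto)
qed

text \<open>
  The windows seen by all points whose image agrees with \<open>y\<close> on a central block, the analogue
  of the symbols at a position in the preimages of a word.
\<close>

definition pre_windows :: "(int \<Rightarrow> 'b) \<Rightarrow> nat \<Rightarrow> nat \<Rightarrow> (int \<Rightarrow> 'a) set" where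
  "pre_windows y M N = window N ` {x \<in> X. window M (\<pi> x) = window M y}"

definition forces_sync :: "(int \<Rightarrow> 'b) \<Rightarrow> nat \<Rightarrow> nat \<Rightarrow> bool" where
  "forces_sync y M N \<longleftrightarrow> y \<in> Y \<and> r \<le> N \<and> (\<forall>x\<in>X. window M (\<pi> x) = window M y \<longrightarrow> sees N x)"

lemma finite_pre_windows: "finite (pre_windows y M N)"
  by (rule finite_subset[OF _ finite_windows[OF shift_X, of N]]) (auto simp: pre_windows_def)

text \<open>
  The points whose image agrees with \<open>y\<close> up to radius \<open>M\<close>, but whose window is none of the
  windows of the fibre, form a decreasing sequence of closed sets with empty intersection. By
  compactness one of these sets is empty.
\<close>

lemma pre_windows_eventually_fibre:
  "\<exists>M0. \<forall>M\<ge>M0. pre_windows y M N = window N ` fibre y"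
proof -
  define C where "C M = (X \<inter> \<pi> -` {z. window M z = window M y}) \<inter> {x. window N x \<notin> window N ` fibre y}" for M
  have "\<exists>M. X \<inter> C M = {}"
  proof (rule ccontr)
    assume "\<nexists>M. X \<inter> C M = {}"
    moreover have "closed (C M)" for M
      unfolding C_def
    proof (rule closed_Int[OF continuous_closed_preimage[OF _ _ closed_window_pred] closed_window_pred])
      show "continuous_on X \<pi>" using code unfolding factor_code_def by blast
      show "closed X" using shift_X unfolding shift_space_def by blast
    qed
    moreover have "C (Suc M) \<subseteq> C M" for M
    proof -
      have "window M (\<pi> x) = window M y" if "window (Suc M) (\<pi> x) = window (Suc M) y" for x
        by (rule window_mono[OF that]) simp
      then show ?thesis unfolding C_def by blast
    qed
    ultimately obtain x where "x \<in> X" "\<And>M. x \<in> C M"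
      using nested_closed_nonempty[OF shift_X, of C] by blast
    then have "\<And>M. window M (\<pi> x) = window M y" "window N x \<notin> window N ` fibre y" unfolding C_def by auto
    moreover from this(1) have "\<pi> x = y"
    proof (intro ext)
      fix i
      show "\<pi> x i = y i"
        using \<open>\<And>M. window M (\<pi> x) = window M y\<close>[of "nat \<bar>i\<bar>"] unfolding window_eq_iff by simp
    qed
    ultimately show False using \<open>x \<in> X\<close> unfolding fibre_def by auto
  qed
  then obtain M0 where M0: "X \<inter> C M0 = {}" by blast
  have "pre_windows y M N = window N ` fibre y" if "M \<ge> M0" for M
  proof
    show "pre_windows y M N \<subseteq> window N ` fibre y"
      unfolding pre_windows_def
    proof (rule image_subsetI)
      fix x assume "x \<in> {x \<in> X. window M (\<pi> x) = window M y}"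
      then show "window N x \<in> window N ` fibre y"
        using M0 window_mono[OF _ \<open>M \<ge> M0\<close>, of "\<pi> x" y] unfolding C_def by blast
    qed
    show "window N ` fibre y \<subseteq> pre_windows y M N" unfolding pre_windows_def fibre_def by auto
  qed
  then show ?thesis by blast
qed

text \<open>
  The fibre is finite and all its points contain \<open>m\<close>, so one window shows \<open>m\<close> in all of
  them. By compactness a long block of \<open>y\<close> already forces these windows.
\<close>

lemma doubly_transitive_forces_sync:
  assumes "doubly_transitive Y y" obtains M N where "forces_sync y M N"
proof -
  have y: "y \<in> Y" using assms unfolding doubly_transitive_def by blast
  have "\<exists>N. sees N x" if x: "x \<in> fibre y" for x
  proof -
    have "\<exists>i. block (\<pi> x) i (length w) = w" if "w \<in> language Y" for w
      using assms x that unfolding doubly_transitive_def fibre_def by blast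
    then obtain i where "block x i (length m) = m"
      using transitive_preimage_sees_sync[of x] x unfolding fibre_def by blast
    then have "sees (nat \<bar>i\<bar> + length m) x" unfolding sees_def by (intro exI[of _ i]) auto
    then show ?thesis by blast
  qed
  then obtain n where n: "\<And>x. x \<in> fibre y \<Longrightarrow> sees (n x) x" by metis
  define N where "N = Max (insert r (n ` fibre y))"
  have fin: "finite (insert r (n ` fibre y))" using finite_fibre[OF y] by simp
  have sees: "sees N x" if "x \<in> fibre y" for x
    using sees_mono[OF n[OF that]] Max_ge[OF fin] that unfolding N_def by blast
  obtain M where M: "pre_windows y M N = window N ` fibre y"
    using pre_windows_eventually_fibre[of y N] by blast
  have "sees N x" if x: "x \<in> X" "window M (\<pi> x) = window M y" for x
  proof -
    have "window N x \<in> pre_windows y M N" using x unfolding pre_windows_def by blast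
    then obtain x' where "x' \<in> fibre y" "window N x = window N x'" unfolding M by blast
    then show ?thesis using sees_cong[of N x' x] sees by simp
  qed
  moreover have "r \<le> N" unfolding N_def by (rule Max_ge[OF fin]) simp
  ultimately show ?thesis using y by (intro that[of M N]) (simp add: forces_sync_def)
qed

text \<open>
  The counterpart of a magic word: a central block of \<open>Y\<close> with as few windows over it as
  possible, among the blocks over which each window shows the synchronizing word.
\<close>

definition magic :: "(int \<Rightarrow> 'b) \<Rightarrow> nat \<Rightarrow> nat \<Rightarrow> bool" where
  "magic y M N \<longleftrightarrow> forces_sync y M N \<and>
     (\<forall>y' M' N'. forces_sync y' M' N' \<longrightarrow> card (pre_windows y M N) \<le> card (pre_windows y' M' N'))"

lemma magic_exists:
  assumes "forces_sync y M N" obtains y0 M0 N0 where "magic y0 M0 N0"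
proof -
  let ?P = "\<lambda>(y, M, N). forces_sync y M N" and ?f = "\<lambda>(y, M, N). card (pre_windows y M N)"
  obtain t where "?P t" "\<forall>s. ?P s \<longrightarrow> ?f t \<le> ?f s"
    using ex_has_least_nat[of ?P "(y, M, N)" ?f] assms by auto
  then show ?thesis using that by (cases t) (auto simp: magic_def)
qed

text \<open>
  Extending the block can only lose windows, which minimality forbids. So each window over a
  magic block extends to a point of the fibre of every \<open>y\<close> in which the block occurs.
\<close>

lemma magic_windows:
  assumes min: "magic y0 M0 N0" and y: "y \<in> Y" "window M0 y = window M0 y0"
  shows "window N0 ` fibre y = pre_windows y0 M0 N0"
proof -
  obtain M1 where M1: "\<forall>M\<ge>M1. pre_windows y M N0 = window N0 ` fibre y"
    using pre_windows_eventually_fibre[of y N0] by blast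
  define M where "M = max M0 M1"
  have *: "window M0 (\<pi> x) = window M0 y0" if "window M (\<pi> x) = window M y" for x
    using window_mono[OF that, of M0] y(2) by (simp add: M_def)
  have "forces_sync y M N0" using min y(1) * unfolding magic_def forces_sync_def by blast
  then have "card (pre_windows y0 M0 N0) \<le> card (pre_windows y M N0)" using min unfolding magic_def by blast
  moreover have "pre_windows y M N0 \<subseteq> pre_windows y0 M0 N0" unfolding pre_windows_def using * by blast
  ultimately have "pre_windows y M N0 = pre_windows y0 M0 N0"
    by (intro card_seteq finite_pre_windows)
  then show ?thesis using M1[rule_format, of M] by (simp add: M_def)
qed

lemma magic_match:
  assumes min: "magic y0 M0 N0" and "y \<in> Y" "y1 \<in> Y"
    and win: "window M0 (shift_by p y) = window M0 y0" "window M0 (shift_by p y1) = window M0 y0"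
    and x: "x \<in> fibre y"
  obtains f where "f \<in> fibre y1" "window N0 (shift_by p f) = window N0 (shift_by p x)"
proof -
  have "window N0 ` fibre (shift_by p y) = window N0 ` fibre (shift_by p y1)"
    using magic_windows[OF min _ win(1)] magic_windows[OF min _ win(2)] assms(2,3)
    by (simp add: shift_space_shift_by[OF shift_Y])
  then have "window N0 (shift_by p x) \<in> window N0 ` shift_by p ` fibre y1"
    using x unfolding fibre_shift_by by blast
  then obtain f where "f \<in> fibre y1" "window N0 (shift_by p x) = window N0 (shift_by p f)" by blast
  then show ?thesis by (intro that[of f]) simp_all
qed

text \<open>
  If \<open>y1\<close> repeats a stretch of \<open>y\<close> between two occurrences of a magic block, then the part
  of a preimage of \<open>y\<close> over this stretch can be put into preimages of \<open>y1\<close> that have the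
  matching windows at the two ends.
\<close>

lemma transplant:
  assumes min: "magic y0 M0 N0" and y1: "y1 \<in> Y" and "p \<le> q"
    and winp: "window M0 (shift_by p y) = window M0 y0" and winq: "window M0 (shift_by q y) = window M0 y0"
    and eq: "\<And>i. p - int M0 \<le> i \<Longrightarrow> i \<le> q + int M0 \<Longrightarrow> y1 i = y i"
    and x: "x \<in> fibre y" and f: "f \<in> fibre y1" "f' \<in> fibre y1"
    and fp: "window N0 (shift_by p f) = window N0 (shift_by p x)"
    and fq: "window N0 (shift_by q f') = window N0 (shift_by q x)"
  shows "(\<lambda>i. if i \<le> p then f i else if i \<le> q then x i else f' i) \<in> fibre y1" (is "?g \<in> _")
proof -
  have "r \<le> N0" using min unfolding magic_def forces_sync_def by blast
  have in_X: "x \<in> X" "f \<in> X" "f' \<in> X" and im: "\<pi> x = y" "\<pi> f = y1" "\<pi> f' = y1"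
    using x f unfolding fibre_def by auto
  have see: "sees N0 (shift_by s h)" if "h \<in> fibre y" "window M0 (shift_by s y) = window M0 y0" for h s
    using min that unfolding magic_def forces_sync_def fibre_def by (auto simp: shift_in code_shift_by)
  have seep: "sees N0 (shift_by p f)"
    by (rule sees_cong[OF fp[symmetric] see[OF x winp]])
  have seeq: "sees N0 (shift_by q x)" by (rule see[OF x winq])
  define g where "g = (\<lambda>i. if i \<le> p then f i else x i)"
  note g = glue[OF in_X(2,1) \<open>r \<le> N0\<close> fp seep, folded g_def]
  have gq: "window N0 (shift_by q g) = window N0 (shift_by q x)"
    unfolding window_eq_iff shift_by_apply
  proof (intro allI impI)
    fix i assume "\<bar>i\<bar> \<le> int N0"
    then show "g (i + q) = x (i + q)"
      using fp[unfolded window_eq_iff shift_by_apply, rule_format, of "i + q - p"] \<open>p \<le> q\<close>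
      unfolding g_def by auto
  qed
  have gf: "window N0 (shift_by q g) = window N0 (shift_by q f')" using gq fq by simp
  define g2 where "g2 = (\<lambda>i. if i \<le> q then g i else f' i)"
  note g2 = glue[OF g(1) in_X(3) \<open>r \<le> N0\<close> gf sees_cong[OF gq[symmetric] seeq], folded g2_def]
  have "\<pi> g2 i = y1 i" for i
  proof -
    consider "i \<le> p" | "p < i" "i \<le> q" | "q < i" by linarith
    then show ?thesis
      using g2(2,3)[of i] g(2,3)[of i] im eq[of i] \<open>p \<le> q\<close> by cases auto
  qed
  then have "g2 \<in> fibre y1" using g2(1) unfolding fibre_def by auto
  moreover have "g2 = ?g" using \<open>p \<le> q\<close> unfolding g2_def g_def by auto
  ultimately show ?thesis by simp
qed

text \<open>
  Two preimages \<open>x\<close> and \<open>z\<close> of \<open>y\<close> can be transplanted into the same surroundings at an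
  end at which their windows coincide. The outer parts are picked by a choice function of the
  window, so equal windows get equal outer parts.
\<close>

lemma branch:
  assumes min: "magic y0 M0 N0" and y: "y \<in> Y" "y1 \<in> Y" and "p \<le> q"
    and winp: "window M0 (shift_by p y) = window M0 y0" and winq: "window M0 (shift_by q y) = window M0 y0"
    and eq: "\<And>i. p - int M0 \<le> i \<Longrightarrow> i \<le> q + int M0 \<Longrightarrow> y1 i = y i"
    and x: "x \<in> fibre y" and z: "z \<in> fibre y"
  shows "\<exists>g\<in>fibre y1. \<exists>h\<in>fibre y1. (\<forall>i. p < i \<and> i \<le> q \<longrightarrow> g i = x i \<and> h i = z i) \<and>
    (window N0 (shift_by p x) = window N0 (shift_by p z) \<longrightarrow> (\<forall>i\<le>p. g i = h i)) \<and>
    (window N0 (shift_by q x) = window N0 (shift_by q z) \<longrightarrow> (\<forall>i>q. g i = h i))"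
proof -
  define F where "F s u = (SOME f. f \<in> fibre y1 \<and> window N0 (shift_by s f) = window N0 (shift_by s u))" for s u
  have F: "F s u \<in> fibre y1 \<and> window N0 (shift_by s (F s u)) = window N0 (shift_by s u)"
    if u: "u \<in> fibre y" and s: "s \<in> {p, q}" for s u
  proof -
    have 1: "window M0 (shift_by s y) = window M0 y0" using winp winq s by blast
    have "window M0 (shift_by s y1) = window M0 (shift_by s y)"
      unfolding window_eq_iff shift_by_apply using s \<open>p \<le> q\<close> by (intro allI impI eq) auto
    then have 2: "window M0 (shift_by s y1) = window M0 y0" using 1 by simp
    have "\<exists>f. f \<in> fibre y1 \<and> window N0 (shift_by s f) = window N0 (shift_by s u)"
      by (rule magic_match[OF min y 1 2 u]) blast
    then show ?thesis unfolding F_def by (rule someI_ex)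
  qed
  have F_cong: "F s x = F s z" if "window N0 (shift_by s x) = window N0 (shift_by s z)" for s
    unfolding F_def that ..
  define g where "g u i = (if i \<le> p then F p u i else if i \<le> q then u i else F q u i)" for u i
  have g_in: "g u \<in> fibre y1" if u: "u \<in> fibre y" for u
  proof -
    have "g u = (\<lambda>i. if i \<le> p then F p u i else if i \<le> q then u i else F q u i)"
      unfolding g_def ..
    also have "\<dots> \<in> fibre y1"
      by (rule transplant[OF min y(2) \<open>p \<le> q\<close> winp winq eq u]) (use F[OF u] in simp_all)
    finally show ?thesis .
  qed
  have "g x i = x i \<and> g z i = z i" if "p < i \<and> i \<le> q" for i using that by (simp add: g_def)
  moreover have "g x i = g z i" if "window N0 (shift_by p x) = window N0 (shift_by p z)" "i \<le> p" for i
    using that(2) F_cong[OF that(1)] by (simp add: g_def)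
  moreover have "g x i = g z i" if "window N0 (shift_by q x) = window N0 (shift_by q z)" "q < i" for i
    using that(2) F_cong[OF that(1)] \<open>p \<le> q\<close> by (simp add: g_def)
  ultimately show ?thesis by (intro bexI[OF _ g_in[OF x]] bexI[OF _ g_in[OF z]] conjI impI allI) simp_all
qed

text \<open>
  Suppose two preimages of \<open>y\<close> agree on the window over a magic block but differ, say, to its
  right. The stretch up to a later occurrence of the block recurs in \<open>y\<close> arbitrarily far to
  the right. Transplanting there gives two different preimages of \<open>y\<close> that agree on everything
  to the left. This is impossible far enough out, because a fixed window separates the points of
  the finite fibre.
\<close>

lemma magic_window_injective:
  assumes min: "magic y0 M0 N0" and dt: "doubly_transitive Y y" and win: "window M0 y = window M0 y0"
  shows "inj_on (window N0) (fibre y)"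
proof (rule inj_onI, rule ccontr)
  fix x z assume x: "x \<in> fibre y" and z: "z \<in> fibre y" and xz: "window N0 x = window N0 z" and "x \<noteq> z"
  then obtain c where c: "x c \<noteq> z c" by blast
  then have "c \<noteq> 0" using xz unfolding window_eq_iff by (auto dest: spec[of _ c])
  have y: "y \<in> Y" and y0: "y0 \<in> Y" using dt min unfolding doubly_transitive_def magic_def forces_sync_def by blast+
  obtain T where T: "inj_on (window T) (fibre y)" using finite_separating_window[OF finite_fibre[OF y]] .
  have win0: "window M0 (shift_by 0 y) = window M0 y0" using win by simp
  have xz0: "window N0 (shift_by 0 x) = window N0 (shift_by 0 z)" using xz by simp
  have eqI: "g = h" if g: "g \<in> fibre (shift_by t y)" "h \<in> fibre (shift_by t y)"
    "\<And>i. \<bar>i\<bar> \<le> int T \<Longrightarrow> g (i - t) = h (i - t)" for g h t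
  proof -
    obtain g' h' where h: "g' \<in> fibre y" "g = shift_by t g'" "h' \<in> fibre y" "h = shift_by t h'"
      using g(1,2) unfolding fibre_shift_by by blast
    have "window T g' = window T h'"
      unfolding window_eq_iff using g(3) unfolding h(2,4) shift_by_apply by simp
    then show ?thesis using T h unfolding inj_on_def by blast
  qed
  have copy: "shift_by t y i = y i" if "window Q (shift_by t y) = window Q y" "\<bar>i\<bar> \<le> int Q" for t Q i
    using that unfolding window_eq_iff by blast
  show False
  proof (cases "c > 0")
    case True
    obtain q where q: "q \<ge> c" "window M0 (shift_by q y) = window M0 y0"
      using doubly_transitive_window(1)[OF dt y0] by blast
    obtain t where t: "t \<ge> int T" "window (M0 + nat q) (shift_by t y) = window (M0 + nat q) y"
      using doubly_transitive_window(1)[OF dt y] by blast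
    have eq: "shift_by t y i = y i" if "0 - int M0 \<le> i" "i \<le> q + int M0" for i
      by (rule copy[OF t(2)]) (use that q(1) True in auto)
    have "0 \<le> q" using q(1) True by simp
    from branch[OF min y shift_space_shift_by[OF shift_Y y] this win0 q(2) eq x z]
    obtain g h where gh: "g \<in> fibre (shift_by t y)" "h \<in> fibre (shift_by t y)"
      "\<forall>i. 0 < i \<and> i \<le> q \<longrightarrow> g i = x i \<and> h i = z i" "\<forall>i\<le>0. g i = h i"
      using xz0 by blast
    have "g = h" by (rule eqI[OF gh(1,2)], rule gh(4)[rule_format]) (use t(1) in auto)
    then show False using gh(3)[rule_format, of c] True q(1) c by auto
  next
    case False
    \<comment> \<open>The transplanted parts begin at \<open>p + 1\<close>, so \<open>p\<close> must be strictly smaller than \<open>c\<close>.\<close>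
    obtain p where p: "p \<le> c - 1" "window M0 (shift_by p y) = window M0 y0"
      using doubly_transitive_window(2)[OF dt y0] by blast
    obtain t where t: "t \<le> - int T - 1" "window (M0 + nat (- p)) (shift_by t y) = window (M0 + nat (- p)) y"
      using doubly_transitive_window(2)[OF dt y] by blast
    have eq: "shift_by t y i = y i" if "p - int M0 \<le> i" "i \<le> 0 + int M0" for i
      by (rule copy[OF t(2)]) (use that p(1) False in auto)
    have "p \<le> 0" using p(1) False by simp
    from branch[OF min y shift_space_shift_by[OF shift_Y y] this p(2) win0 eq x z]
    obtain g h where gh: "g \<in> fibre (shift_by t y)" "h \<in> fibre (shift_by t y)"
      "\<forall>i. p < i \<and> i \<le> 0 \<longrightarrow> g i = x i \<and> h i = z i" "\<forall>i>0. g i = h i"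
      using xz0 by blast
    have "g = h" by (rule eqI[OF gh(1,2)], rule gh(4)[rule_format]) (use t(1) in auto)
    then show False using gh(3)[rule_format, of c] False \<open>c \<noteq> 0\<close> p(1) c by auto
  qed
qed

lemma card_fibre_doubly_transitive:
  assumes min: "magic y0 M0 N0" and dt: "doubly_transitive Y y"
  shows "card (fibre y) = card (pre_windows y0 M0 N0)"
proof -
  have y0: "y0 \<in> Y" and y: "y \<in> Y" using dt min unfolding doubly_transitive_def magic_def forces_sync_def by blast+
  obtain p where p: "window M0 (shift_by p y) = window M0 y0"
    using doubly_transitive_window(1)[OF dt y0] by blast
  have "card (fibre y) = card (fibre (shift_by p y))" by (rule card_fibre_shift_by[symmetric])
  also have "\<dots> = card (window N0 ` fibre (shift_by p y))"
    by (rule card_image[symmetric], rule magic_window_injective[OF min _ p])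
      (rule doubly_transitive_shift_by[OF shift_Y dt])
  also have "\<dots> = card (pre_windows y0 M0 N0)"
    using magic_windows[OF min shift_space_shift_by[OF shift_Y y] p] by simp
  finally show ?thesis .
qed

text \<open>
  The number of windows over a magic block does not depend on \<open>y\<close>, which makes the definite
  description of the degree meaningful as soon as there is a doubly transitive point.
\<close>

theorem card_fibre_eq_code_degree:
  assumes dt: "doubly_transitive Y y"
  shows "card (fibre y) = code_degree X Y \<pi>"
proof -
  obtain M N where "forces_sync y M N" using doubly_transitive_forces_sync[OF dt] .
  then obtain y0 M0 N0 where min: "magic y0 M0 N0" by (rule magic_exists)
  let ?d = "card (pre_windows y0 M0 N0)"
  have card: "finite (fibre y) \<and> card (fibre y) = ?d" if "doubly_transitive Y y" for y
    using finite_fibre card_fibre_doubly_transitive[OF min that] that unfolding doubly_transitive_def by blast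
  have "code_degree X Y \<pi> = ?d"
    unfolding code_degree_def fibre_def[symmetric]
    by (rule the_equality) (use card dt in auto)
  then show ?thesis using card[OF dt] by simp
qed

end

section \<open>Ergodic measures\<close>

lemma invariant_prob_funpow:
  assumes "invariant_prob T M" "A \<in> sets M"
  shows "(T ^^ k) -` A \<inter> space M \<in> sets M \<and> measure M ((T ^^ k) -` A \<inter> space M) = measure M A"
proof (induction k)
  case 0
  then show ?case using assms(2) sets.sets_into_space[OF assms(2)] by (simp add: Int_absorb2)
next
  case (Suc k)
  let ?B = "(T ^^ k) -` A \<inter> space M"
  have T: "T \<in> measurable M M" "distr M M T = M" using assms(1) unfolding invariant_prob_def by auto
  have eq: "(T ^^ Suc k) -` A \<inter> space M = T -` ?B \<inter> space M"
    using measurable_space[OF T(1)] by (auto simp: funpow_swap1)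
  have 1: "T -` ?B \<inter> space M \<in> sets M" by (rule measurable_sets[OF T(1) conjunct1[OF Suc]])
  have "measure (distr M M T) ?B = measure M (T -` ?B \<inter> space M)"
    by (rule measure_distr[OF T(1) conjunct1[OF Suc]])
  then have "measure M (T -` ?B \<inter> space M) = measure M A" using conjunct2[OF Suc] unfolding T(2) by (simp only:)
  then show ?case unfolding eq using 1 by (simp only: simp_thms)
qed

lemma ergodic_prob_distr:
  assumes erg: "ergodic_prob T M" and g: "g \<in> measurable M N" and S: "S \<in> measurable N N"
    and comm: "\<And>x. x \<in> space M \<Longrightarrow> g (T x) = S (g x)"
  shows "ergodic_prob S (distr M N g)"
proof -
  have M: "prob_space M" "T \<in> measurable M M" "distr M M T = M"
    using erg unfolding ergodic_prob_def invariant_prob_def by auto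
  interpret prob_space M by fact
  have pre: "T -` (g -` A \<inter> space M) \<inter> space M = g -` (S -` A \<inter> space N) \<inter> space M" for A
    using comm measurable_space[OF M(2)] measurable_space[OF g] by auto
  have "distr (distr M N g) (distr M N g) S = distr M N g"
  proof (rule measure_eqI)
    fix A assume "A \<in> sets (distr (distr M N g) (distr M N g) S)"
    then have A: "A \<in> sets N" by simp
    have gA: "g -` A \<inter> space M \<in> sets M" by (rule measurable_sets[OF g A])
    have "emeasure (distr (distr M N g) (distr M N g) S) A = emeasure (distr M N g) (S -` A \<inter> space N)"
      using S A by (subst emeasure_distr) simp_all
    also have "\<dots> = emeasure M (T -` (g -` A \<inter> space M) \<inter> space M)"
      unfolding pre by (rule emeasure_distr[OF g measurable_sets[OF S A]])
    also have "\<dots> = emeasure (distr M M T) (g -` A \<inter> space M)"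
      by (rule emeasure_distr[OF M(2) gA, symmetric])
    also have "\<dots> = emeasure (distr M N g) A" using M(3) emeasure_distr[OF g A] by simp
    finally show "emeasure (distr (distr M N g) (distr M N g) S) A = emeasure (distr M N g) A" .
  qed simp
  moreover have "measure (distr M N g) A = 0 \<or> measure (distr M N g) A = 1"
    if "A \<in> sets N" "S -` A \<inter> space N = A" for A
  proof -
    have "T -` (g -` A \<inter> space M) \<inter> space M = g -` A \<inter> space M" using pre[of A] that(2) by simp
    then show ?thesis
      using erg measurable_sets[OF g that(1)] measure_distr[OF g that(1)] unfolding ergodic_prob_def by auto
  qed
  ultimately show ?thesis
    using prob_space_distr[OF g] S unfolding ergodic_prob_def invariant_prob_def by simp
qed

text \<open>
  Let \<open>\<delta>\<close> be the difference of the two measures and \<open>H\<close> a Hahn set, on which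
  \<open>\<delta>\<close> is maximal. By invariance the preimages of \<open>H\<close> are maximal too, and the maximal
  sets are closed under unions because \<open>\<delta>\<close> is additive. The union of all preimages of
  \<open>H\<close> is contracted by taking preimages, and intersecting its preimages gives a strictly
  invariant set on which \<open>\<delta>\<close> is still maximal, hence positive. By ergodicity the two
  measures of this set are \<open>1\<close> and \<open>0\<close>.
\<close>

lemma ergodic_mutually_singular:
  assumes P: "ergodic_prob T P" and Q: "ergodic_prob T Q" and sets: "sets Q = sets P" and "P \<noteq> Q"
  shows "\<exists>B\<in>sets P. measure P B = 1 \<and> measure Q B = 0"
proof -
  have inv: "invariant_prob T P" "invariant_prob T Q" using P Q unfolding ergodic_prob_def by auto
  have sp: "space Q = space P" by (rule sets_eq_imp_space_eq[OF sets])
  interpret P: prob_space P using inv(1) unfolding invariant_prob_def by blast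
  interpret Q: prob_space Q using inv(2) unfolding invariant_prob_def by blast
  define \<delta> where "\<delta> A = measure P A - measure Q A" for A
  have Un: "\<delta> (A \<union> B) = \<delta> A + \<delta> B - \<delta> (A \<inter> B)" if "A \<in> sets P" "B \<in> sets P" for A B
    unfolding \<delta>_def using that sets
    by (simp add: measure_Un3 P.fmeasurable_eq_sets Q.fmeasurable_eq_sets)
  obtain H where H: "H \<in> sets P"
    and pos: "\<And>A. A \<in> sets P \<Longrightarrow> A \<subseteq> H \<Longrightarrow> \<delta> A \<ge> 0" and neg: "\<And>A. A \<in> sets P \<Longrightarrow> A \<inter> H = {} \<Longrightarrow> \<delta> A \<le> 0"
  proof -
    obtain H where H: "H \<in> sets P" "\<forall>A\<in>sets P. A \<subseteq> H \<longrightarrow> emeasure Q A \<le> emeasure P A"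
      "\<forall>A\<in>sets P. A \<inter> H = {} \<longrightarrow> emeasure P A \<le> emeasure Q A"
      using finite_unsigned_Hahn_decomposition[OF P.finite_measure_axioms Q.finite_measure_axioms sets] by blast
    show ?thesis
      by (rule that[OF H(1)]) (use H(2,3) in \<open>auto simp: \<delta>_def P.emeasure_eq_measure Q.emeasure_eq_measure\<close>)
  qed
  have max: "\<delta> A \<le> \<delta> H" if A: "A \<in> sets P" for A
  proof -
    have "\<delta> A = \<delta> (A \<inter> H) + \<delta> (A - H)"
      using Un[of "A \<inter> H" "A - H"] A H by (simp add: Int_Diff_Un \<delta>_def Int_Diff_disjoint)
    moreover have "\<delta> H = \<delta> (A \<inter> H) + \<delta> (H - A)"
      using Un[of "A \<inter> H" "H - A"] A H by (simp add: \<delta>_def Int_commute[of A] Int_Diff_Un Int_Diff_disjoint)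
    moreover have "\<delta> (A - H) \<le> 0" "\<delta> (H - A) \<ge> 0" using A H by (auto intro!: neg pos)
    ultimately show ?thesis by simp
  qed
  have "\<delta> H > 0"
  proof -
    have "\<exists>A\<in>sets P. measure P A \<noteq> measure Q A"
    proof (rule ccontr)
      assume "\<not> (\<exists>A\<in>sets P. measure P A \<noteq> measure Q A)"
      then have "P = Q"
        by (intro measure_eqI) (simp_all add: sets P.emeasure_eq_measure Q.emeasure_eq_measure)
      then show False using \<open>P \<noteq> Q\<close> by blast
    qed
    then obtain A where A: "A \<in> sets P" "\<delta> A \<noteq> 0" unfolding \<delta>_def by auto
    have "\<delta> (space P - A) = - \<delta> A"
      using A(1) P.prob_compl[of A] Q.prob_compl[of A] sets sp by (simp add: \<delta>_def)
    then show ?thesis using max[OF A(1)] max[of "space P - A"] A by auto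
  qed
  have fp: "(T ^^ k) -` A \<inter> space P \<in> sets P" "measure P ((T ^^ k) -` A \<inter> space P) = measure P A"
    "measure Q ((T ^^ k) -` A \<inter> space P) = measure Q A" if "A \<in> sets P" for A k
    using invariant_prob_funpow[OF inv(1) that, of k] invariant_prob_funpow[OF inv(2), of A k] that sets sp
    by auto
  have T: "T x \<in> space P" if "x \<in> space P" for x
    using inv(1) that unfolding invariant_prob_def by (blast dest: measurable_space)
  define V where "V k = (T ^^ k) -` H \<inter> space P" for k
  define U where "U n = (\<Union>k\<le>n. V k)" for n
  have V: "V k \<in> sets P" "\<delta> (V k) = \<delta> H" for k unfolding V_def \<delta>_def using fp[OF H] by simp_all
  have U: "U n \<in> sets P" for n unfolding U_def using V(1) by (intro sets.finite_UN) auto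
  have dU: "\<delta> (U n) = \<delta> H" for n
  proof (induction n)
    case 0
    then show ?case using V(2)[of 0] by (simp add: U_def)
  next
    case (Suc n)
    have "U (Suc n) = U n \<union> V (Suc n)" unfolding U_def by (simp add: atMost_Suc Un_commute)
    then have "\<delta> (U (Suc n)) = \<delta> H + \<delta> H - \<delta> (U n \<inter> V (Suc n))"
      using Un[OF U V(1), of n "Suc n"] V(2) Suc by simp
    moreover have "\<delta> (U n \<inter> V (Suc n)) \<le> \<delta> H" by (rule max) (intro sets.Int U V(1))
    ultimately show ?case using max[OF U[of "Suc n"]] by linarith
  qed
  define B1 where "B1 = (\<Union>n. U n)"
  have B1: "B1 \<in> sets P" unfolding B1_def using U by (intro sets.countable_UN) auto
  have incU: "incseq U" unfolding U_def by (intro monoI UN_mono) auto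
  have "(\<lambda>n. measure P (U n) - measure Q (U n)) \<longlonglongrightarrow> measure P B1 - measure Q B1"
    unfolding B1_def
    by (intro tendsto_diff P.finite_Lim_measure_incseq Q.finite_Lim_measure_incseq incU) (use U sets in auto)
  then have "(\<lambda>n. \<delta> H) \<longlonglongrightarrow> \<delta> B1" unfolding \<delta>_def[symmetric] dU .
  then have dB1: "\<delta> B1 = \<delta> H" by (simp add: LIMSEQ_const_iff)
  define W where "W n = (T ^^ n) -` B1 \<inter> space P" for n
  have W: "W n \<in> sets P" "measure P (W n) = measure P B1" "measure Q (W n) = measure Q B1" for n
    unfolding W_def using fp[OF B1] by simp_all
  \<comment> \<open>The union of all preimages of \<open>H\<close> absorbs preimages, which makes the sets \<open>W n\<close>
    decrease.\<close>
  have TB1: "x \<in> B1" if x: "x \<in> space P" "T x \<in> B1" for x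
  proof -
    obtain k where "T x \<in> V k" using x(2) unfolding B1_def U_def by blast
    then have "x \<in> V (Suc k)" using x(1) unfolding V_def by (simp add: funpow_swap1)
    then show ?thesis unfolding B1_def U_def by blast
  qed
  have Tn: "(T ^^ n) x \<in> space P" if "x \<in> space P" for n x using that by (induction n) (auto simp: T)
  have WSuc: "W (Suc n) \<subseteq> W n" for n
    unfolding W_def using TB1 Tn by auto
  have decW: "decseq W" using WSuc by (rule decseq_SucI)
  define B2 where "B2 = (\<Inter>n. W n)"
  have B2: "B2 \<in> sets P" unfolding B2_def using W(1) by (intro sets.countable_INT) auto
  have "(\<lambda>n. measure P (W n)) \<longlonglongrightarrow> measure P B2"
    unfolding B2_def by (rule P.finite_Lim_measure_decseq[OF _ decW]) (use W in auto)
  then have PB2: "measure P B2 = measure P B1" unfolding W by (simp add: LIMSEQ_const_iff)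
  have "(\<lambda>n. measure Q (W n)) \<longlonglongrightarrow> measure Q B2"
    unfolding B2_def by (rule Q.finite_Lim_measure_decseq[OF _ decW]) (use W sets in auto)
  then have QB2: "measure Q B2 = measure Q B1" unfolding W by (simp add: LIMSEQ_const_iff)
  have TW: "T -` W n \<inter> space P = W (Suc n)" for n
    unfolding W_def using T by (auto simp: funpow_swap1)
  have "T -` B2 \<inter> space P = (\<Inter>n. T -` W n \<inter> space P)" unfolding B2_def by blast
  also have "\<dots> = (\<Inter>n. W (Suc n))" by (simp only: TW)
  also have "\<dots> = B2" unfolding B2_def using WSuc by blast
  finally have TB2: "T -` B2 \<inter> space P = B2" .
  have "measure P B2 = 0 \<or> measure P B2 = 1" "measure Q B2 = 0 \<or> measure Q B2 = 1"
    using P Q B2 TB2 sets sp unfolding ergodic_prob_def by auto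
  moreover have "measure P B2 - measure Q B2 > 0" using dB1 \<open>\<delta> H > 0\<close> PB2 QB2 by (simp add: \<delta>_def)
  ultimately have "measure P B2 = 1 \<and> measure Q B2 = 0" by auto
  then show ?thesis using B2 by blast
qed

section \<open>Doubly transitive points have full measure\<close>

text \<open>
  Continuity from above gives the intersection at least the measure \<open>c\<close>, and ergodicity then
  leaves only the measure \<open>1\<close>. For the sets of points that visit a cylinder at some time after
  \<open>n\<close> this is recurrence.
\<close>

lemma ergodic_decreasing_AE:
  assumes erg: "ergodic_prob T M" and D: "\<And>n. D n \<in> sets M" "decseq D"
    and c: "c > 0" "\<And>n::nat. c \<le> measure M (D n)" and inv: "T -` (\<Inter>n. D n) \<inter> space M = (\<Inter>n. D n)"
  shows "AE x in M. \<forall>n. x \<in> D n"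
proof -
  interpret prob_space M using erg unfolding ergodic_prob_def invariant_prob_def by blast
  have sets: "(\<Inter>n. D n) \<in> sets M" using D(1) by (intro sets.countable_INT) auto
  have "(\<lambda>n. measure M (D n)) \<longlonglongrightarrow> measure M (\<Inter>n. D n)"
    by (rule finite_Lim_measure_decseq[OF _ D(2)]) (use D(1) in auto)
  then have "c \<le> measure M (\<Inter>n. D n)" by (rule LIMSEQ_le_const) (use c(2) in blast)
  then have "measure M (\<Inter>n. D n) = 1"
    using erg sets inv c(1) unfolding ergodic_prob_def by fastforce
  then have "AE x in M. x \<in> (\<Inter>n. D n)" using prob_eq_1[OF sets] by simp
  then show ?thesis by simp
qed

lemma open_block: "open {y :: int \<Rightarrow> 'a::discrete_topology. block y i n = w}"
proof -
  have "block (window (nat \<bar>i\<bar> + n) y) i n = block y i n" for y :: "int \<Rightarrow> 'a"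
    unfolding block_eq_iff window_def restrict_def by auto
  then show ?thesis using open_window_pred[of "\<lambda>u. block u i n = w" "nat \<bar>i\<bar> + n"] by simp
qed

text \<open>
  By full support every cylinder of \<open>Y\<close> has positive measure, so by ergodicity almost every
  point visits it arbitrarily late and arbitrarily early. There are countably many words.
\<close>

lemma AE_doubly_transitive:
  fixes Y :: "(int \<Rightarrow> 'b::discrete_topology) set"
  assumes Y: "shift_space Y" and "ergodic_measure_on Y \<nu>" and supp: "fully_supported_on Y \<nu>"
  shows "AE y in \<nu>. doubly_transitive Y y"
proof -
  have sets: "sets \<nu> = sets (borel_on Y)" and erg: "ergodic_prob shift_map \<nu>"
    using assms(2) unfolding ergodic_measure_on_def by auto
  have sp: "space \<nu> = Y" using sets_eq_imp_space_eq[OF sets] by (simp add: space_restrict_space)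
  have inv: "invariant_prob shift_map \<nu>" using erg unfolding ergodic_prob_def by blast
  interpret prob_space \<nu> using inv unfolding invariant_prob_def by blast
  have shift: "shift_map y \<in> Y" if "y \<in> Y" for y
    using shift_space_shift_by[OF Y that, of 1] by (simp add: shift_by_1)
  define C where "C w i = {y \<in> Y. block y i (length w) = w}" for w i
  have C: "C w i \<in> sets \<nu>" for w i
  proof -
    have "C w i = {y. block y i (length w) = w} \<inter> Y" unfolding C_def by auto
    then show ?thesis unfolding sets sets_restrict_space using borel_open[OF open_block] by blast
  qed
  have Csuc: "measure \<nu> (C w (i + 1)) = measure \<nu> (C w i)" for w i
  proof -
    have "(shift_map ^^ 1) -` C w i \<inter> space \<nu> = C w (i + 1)"
      unfolding C_def sp using shift by (auto simp flip: shift_by_1 simp: block_shift_by)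
    then show ?thesis using invariant_prob_funpow[OF inv C, of 1 w i] by simp
  qed
  have Cmeas: "measure \<nu> (C w i) = measure \<nu> (C w 0)" for w i
  proof (induction i rule: int_induct[of _ 0])
    case (step2 i)
    then show ?case using Csuc[of w "i - 1"] by simp
  qed (simp_all add: Csuc)
  have pos: "measure \<nu> (C w 0) > 0" if w: "w \<in> language Y" for w
  proof -
    obtain z where "z \<in> Y" "block z 0 (length w) = w" using shift_space_language_block[OF Y w] .
    then have "{y. block y 0 (length w) = w} \<inter> Y \<noteq> {}" by blast
    moreover have "C w 0 = {y. block y 0 (length w) = w} \<inter> Y" unfolding C_def by auto
    ultimately show ?thesis using supp open_block[of 0 "length w" w] unfolding fully_supported_on_def by metis
  qed
  \<comment> \<open>The sets \<open>S n\<close> are the tails \<open>{int n..}\<close> or \<open>{..- int n}\<close>; both directions are treated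
    at once.\<close>
  have AE1: "AE y in \<nu>. \<forall>n::nat. y \<in> (\<Union>i\<in>S n. C w i)"
    if w: "w \<in> language Y" and S: "\<And>n. S n \<noteq> {}" "\<And>m n. m \<le> n \<Longrightarrow> S n \<subseteq> S m"
      and shiftS: "\<And>n i. i \<in> S (Suc n) \<Longrightarrow> i + 1 \<in> S n \<and> i - 1 \<in> S n" for w and S :: "nat \<Rightarrow> int set"
  proof (rule ergodic_decreasing_AE[OF erg _ _ pos[OF w]])
    show UC: "(\<Union>i\<in>S n. C w i) \<in> sets \<nu>" for n
      by (rule sets.countable_UN'') (simp_all add: C)
    show "decseq (\<lambda>n. \<Union>i\<in>S n. C w i)" unfolding decseq_def using S(2) by blast
    show "measure \<nu> (C w 0) \<le> measure \<nu> (\<Union>i\<in>S n. C w i)" for n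
    proof -
      obtain i where "i \<in> S n" using S(1)[of n] by blast
      then have "measure \<nu> (C w i) \<le> measure \<nu> (\<Union>i\<in>S n. C w i)"
        by (intro finite_measure_mono UC) blast
      then show ?thesis using Cmeas[of w i] by simp
    qed
    have mem: "shift_map y \<in> C w i \<longleftrightarrow> y \<in> C w (i + 1)" if "y \<in> Y" for y i
      using shift that unfolding C_def by (simp flip: shift_by_1 add: block_shift_by)
    have "shift_map y \<in> (\<Inter>n. \<Union>i\<in>S n. C w i) \<longleftrightarrow> y \<in> (\<Inter>n. \<Union>i\<in>S n. C w i)" if y: "y \<in> Y" for y
    proof
      assume *: "shift_map y \<in> (\<Inter>n. \<Union>i\<in>S n. C w i)"
      show "y \<in> (\<Inter>n. \<Union>i\<in>S n. C w i)"
      proof (rule INT_I)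
        fix n
        obtain i where "i \<in> S (Suc n)" "shift_map y \<in> C w i" using * by blast
        then show "y \<in> (\<Union>i\<in>S n. C w i)" using shiftS[of i n] mem[OF y, of i] by blast
      qed
    next
      assume *: "y \<in> (\<Inter>n. \<Union>i\<in>S n. C w i)"
      show "shift_map y \<in> (\<Inter>n. \<Union>i\<in>S n. C w i)"
      proof (rule INT_I)
        fix n
        obtain i where "i \<in> S (Suc n)" "y \<in> C w i" using * by blast
        then have "i - 1 \<in> S n" "shift_map y \<in> C w (i - 1)" using shiftS[of i n] mem[OF y, of "i - 1"] by auto
        then show "shift_map y \<in> (\<Union>i\<in>S n. C w i)" by blast
      qed
    qed
    moreover have "(\<Inter>n. \<Union>i\<in>S n. C w i) \<subseteq> Y" unfolding C_def by blast
    ultimately show "shift_map -` (\<Inter>n. \<Union>i\<in>S n. C w i) \<inter> space \<nu> = (\<Inter>n. \<Union>i\<in>S n. C w i)"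
      unfolding sp by blast
  qed
  have AE2: "AE y in \<nu>. (\<forall>n::nat. y \<in> (\<Union>i\<in>{int n..}. C w i)) \<and> (\<forall>n::nat. y \<in> (\<Union>i\<in>{..- int n}. C w i))"
    if w: "w \<in> language Y" for w
  proof (rule AE_conjI)
    show "AE y in \<nu>. \<forall>n::nat. y \<in> (\<Union>i\<in>{int n..}. C w i)" by (rule AE1[OF w]) auto
    show "AE y in \<nu>. \<forall>n::nat. y \<in> (\<Union>i\<in>{..- int n}. C w i)" by (rule AE1[OF w]) auto
  qed
  have "AE y in \<nu>. \<forall>w\<in>language Y.
      (\<forall>n::nat. y \<in> (\<Union>i\<in>{int n..}. C w i)) \<and> (\<forall>n::nat. y \<in> (\<Union>i\<in>{..- int n}. C w i))"
    unfolding AE_ball_countable[OF countable_language[OF Y]] using AE2 by blast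
  then show ?thesis
  proof (rule AE_mp, intro AE_I2 impI)
    fix y assume "y \<in> space \<nu>"
      and *: "\<forall>w\<in>language Y. (\<forall>n::nat. y \<in> (\<Union>i\<in>{int n..}. C w i)) \<and> (\<forall>n::nat. y \<in> (\<Union>i\<in>{..- int n}. C w i))"
    show "doubly_transitive Y y"
      unfolding doubly_transitive_def
    proof (intro conjI ballI allI)
      show "y \<in> Y" using \<open>y \<in> space \<nu>\<close> sp by simp
      fix w and N :: int assume w: "w \<in> language Y"
      have "y \<in> (\<Union>i\<in>{int (nat N)..}. C w i)" using * w by blast
      then obtain i where "i \<ge> int (nat N)" "y \<in> C w i" by blast
      then have "N \<le> i" "block y i (length w) = w" unfolding C_def by (linarith, blast)
      then show "\<exists>i\<ge>N. block y i (length w) = w" by blast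
      have "y \<in> (\<Union>i\<in>{..- int (nat (- N))}. C w i)" using * w by blast
      then obtain i where "i \<le> - int (nat (- N))" "y \<in> C w i" by blast
      then have "i \<le> N" "block y i (length w) = w" unfolding C_def by (linarith, blast)
      then show "\<exists>i\<le>N. block y i (length w) = w" by blast
    qed
  qed
qed

section \<open>Cylinders of tuples\<close>

lemma window_pred_sets: "{z \<in> X. P (window L z)} \<in> sets (borel_on (X :: (int \<Rightarrow> 'a::discrete_topology) set))"
proof -
  have "{z \<in> X. P (window L z)} = X \<inter> {z. P (window L z)}" by auto
  then show ?thesis unfolding sets_restrict_space using borel_open[OF open_window_pred] by blast
qed

lemma space_borel_power: "space (borel_power d X) = (\<Pi>\<^sub>E i\<in>{1..d}. X)"
  by (simp add: space_PiM space_restrict_space)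

definition tuple_cylinder ::
  "nat \<Rightarrow> (int \<Rightarrow> 'a) set \<Rightarrow> nat \<Rightarrow> (nat \<Rightarrow> int \<Rightarrow> 'a) \<Rightarrow> (nat \<Rightarrow> int \<Rightarrow> 'a) set" where
  "tuple_cylinder d X L v = {x \<in> \<Pi>\<^sub>E i\<in>{1..d}. X. \<forall>i\<in>{1..d}. window L (x i) = v i}"

lemma tuple_cylinder_sets:
  fixes X :: "(int \<Rightarrow> 'a::discrete_topology) set"
  shows "tuple_cylinder d X L v \<in> sets (borel_power d X)"
proof -
  have "(\<Pi>\<^sub>E i\<in>{1..d}. {z \<in> X. window L z = v i}) \<in> sets (borel_power d X)"
    by (intro sets_PiM_I_finite window_pred_sets) simp
  also have "(\<Pi>\<^sub>E i\<in>{1..d}. {z \<in> X. window L z = v i}) = tuple_cylinder d X L v"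
    unfolding tuple_cylinder_def by (rule set_eqI) (simp only: PiE_iff mem_Collect_eq, blast)
  finally show ?thesis .
qed

text \<open>
  Over a finite alphabet there are countably many cylinders, so each open set of \<open>X\<close> is a
  countable union of cylinders and products of cylinders generate the whole sigma-algebra.
\<close>

lemma sets_borel_power_generated:
  fixes X :: "(int \<Rightarrow> 'a::discrete_topology) set"
  assumes X: "shift_space X" and A: "A \<in> sets (borel_power d X)"
  shows "A \<in> sigma_sets (\<Pi>\<^sub>E i\<in>{1..d}. X) (insert {} (range (\<lambda>(L, v). tuple_cylinder d X L v)))"
proof -
  let ?\<Omega> = "\<Pi>\<^sub>E i\<in>{1..d}. X" and ?G = "insert {} (range (\<lambda>(L, v). tuple_cylinder d X L v))"
  define N where "N = sigma ?\<Omega> ?G"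
  have G: "?G \<subseteq> Pow ?\<Omega>" unfolding tuple_cylinder_def by auto
  have sN: "sets N = sigma_sets ?\<Omega> ?G" and spN: "space N = ?\<Omega>"
    unfolding N_def using G by (simp_all add: sets_measure_of space_measure_of)
  have cyl: "tuple_cylinder d X L v \<in> sets N" for L v
    unfolding sN by (rule sigma_sets.Basic) auto
  have win: "{x \<in> ?\<Omega>. window L (x i) = w} \<in> sets N" if i: "i \<in> {1..d}" for L i w
  proof -
    let ?V = "{v \<in> \<Pi>\<^sub>E j\<in>{1..d}. window L ` X. v i = w}"
    have "finite ?V" using finite_windows[OF X] by (simp add: finite_PiE)
    moreover have "{x \<in> ?\<Omega>. window L (x i) = w} = (\<Union>v\<in>?V. tuple_cylinder d X L v)"
    proof
      show "{x \<in> ?\<Omega>. window L (x i) = w} \<subseteq> (\<Union>v\<in>?V. tuple_cylinder d X L v)"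
      proof
        fix x assume x: "x \<in> {x \<in> ?\<Omega>. window L (x i) = w}"
        then have "(\<lambda>j\<in>{1..d}. window L (x j)) \<in> ?V" using i by auto
        moreover have "x \<in> tuple_cylinder d X L (\<lambda>j\<in>{1..d}. window L (x j))"
          using x unfolding tuple_cylinder_def by simp
        ultimately show "x \<in> (\<Union>v\<in>?V. tuple_cylinder d X L v)" by blast
      qed
      show "(\<Union>v\<in>?V. tuple_cylinder d X L v) \<subseteq> {x \<in> ?\<Omega>. window L (x i) = w}"
        using i unfolding tuple_cylinder_def by auto
    qed
    ultimately show ?thesis using cyl by (simp only: sets.finite_UN)
  qed
  have comp: "(\<lambda>x. x i) \<in> measurable N (borel_on X)" if i: "i \<in> {1..d}" for i
  proof (rule measurable_restrict_space2)
    show "(\<lambda>x. x i) \<in> space N \<rightarrow> X" using i unfolding spN by auto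
    show "(\<lambda>x. x i) \<in> borel_measurable N"
    proof (rule borel_measurableI)
      fix U :: "(int \<Rightarrow> 'a) set" assume U: "open U"
      define W where "W L = {w \<in> window L ` X. \<forall>z. window L z = w \<longrightarrow> z \<in> U}" for L
      have "(\<lambda>x. x i) -` U \<inter> space N = (\<Union>L. \<Union>w\<in>W L. {x \<in> ?\<Omega>. window L (x i) = w})"
      proof
        show "(\<lambda>x. x i) -` U \<inter> space N \<subseteq> (\<Union>L. \<Union>w\<in>W L. {x \<in> ?\<Omega>. window L (x i) = w})"
        proof
          fix x assume x: "x \<in> (\<lambda>x. x i) -` U \<inter> space N"
          then have "x i \<in> U" "x i \<in> X" "x \<in> ?\<Omega>" using i unfolding spN by auto
          obtain L where "\<And>z. window L z = window L (x i) \<Longrightarrow> z \<in> U"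
            using open_contains_window[OF U \<open>x i \<in> U\<close>] by blast
          then have "window L (x i) \<in> W L" unfolding W_def using \<open>x i \<in> X\<close> by blast
          then show "x \<in> (\<Union>L. \<Union>w\<in>W L. {x \<in> ?\<Omega>. window L (x i) = w})" using \<open>x \<in> ?\<Omega>\<close> by blast
        qed
        show "(\<Union>L. \<Union>w\<in>W L. {x \<in> ?\<Omega>. window L (x i) = w}) \<subseteq> (\<lambda>x. x i) -` U \<inter> space N"
          unfolding W_def spN by blast
      qed
      moreover have "(\<Union>w\<in>W L. {x \<in> ?\<Omega>. window L (x i) = w}) \<in> sets N" for L
      proof (rule sets.finite_UN)
        show "finite (W L)" by (rule finite_subset[OF _ finite_windows[OF X, of L]]) (auto simp: W_def)
      qed (rule win[OF i])
      ultimately show "(\<lambda>x. x i) -` U \<inter> space N \<in> sets N" by (simp add: sets.countable_UN)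
    qed
  qed
  have "(\<lambda>x i. x i) \<in> measurable N (borel_power d X)"
  proof (rule measurable_PiM_single'[where f = "\<lambda>i x. x i", OF comp])
    show "(\<lambda>\<omega> i. \<omega> i) \<in> space N \<rightarrow> (\<Pi>\<^sub>E i\<in>{1..d}. space (borel_on X))"
      unfolding spN by (simp add: space_restrict_space)
  qed
  then have "(\<lambda>x i. x i) -` A \<inter> space N \<in> sets N" using A by (rule measurable_sets)
  moreover have "(\<lambda>x i. x i) -` A \<inter> space N = A"
    using sets.sets_into_space[OF A] unfolding space_borel_power spN by auto
  ultimately show ?thesis unfolding sN by simp
qed

text \<open>
  Windows are nested, so two cylinders are disjoint or the finer one is contained in the coarser
  one.
\<close>

lemma Int_stable_tuple_cylinders:
  "Int_stable (insert {} (range (\<lambda>(L, v). tuple_cylinder d X L v)))"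
proof -
  have *: "tuple_cylinder d X L v \<inter> tuple_cylinder d X M u \<in> {{}, tuple_cylinder d X M u}"
    if "L \<le> M" for L M v u
  proof (cases "\<forall>i\<in>{1..d}. window L (u i) = v i")
    case True
    have "tuple_cylinder d X M u \<subseteq> tuple_cylinder d X L v"
    proof
      fix x assume x: "x \<in> tuple_cylinder d X M u"
      have "window L (x i) = v i" if "i \<in> {1..d}" for i
      proof -
        have "window L (window M (x i)) = v i" using x that True unfolding tuple_cylinder_def by simp
        then show ?thesis by (simp add: window_window[OF \<open>L \<le> M\<close>])
      qed
      then show "x \<in> tuple_cylinder d X L v" using x unfolding tuple_cylinder_def by simp
    qed
    then show ?thesis by blast
  next
    case False
    then obtain i where i: "i \<in> {1..d}" "window L (u i) \<noteq> v i" by blast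
    have "x \<notin> tuple_cylinder d X L v" if "x \<in> tuple_cylinder d X M u" for x
    proof
      assume "x \<in> tuple_cylinder d X L v"
      then have "window L (x i) = v i" "window M (x i) = u i"
        using i(1) that unfolding tuple_cylinder_def by simp_all
      then show False using i(2) window_window[OF \<open>L \<le> M\<close>, of "x i"] by simp
    qed
    then show ?thesis by blast
  qed
  show ?thesis
  proof (rule Int_stableI)
    fix a b assume ab: "a \<in> insert {} (range (\<lambda>(L, v). tuple_cylinder d X L v))"
      "b \<in> insert {} (range (\<lambda>(L, v). tuple_cylinder d X L v))"
    show "a \<inter> b \<in> insert {} (range (\<lambda>(L, v). tuple_cylinder d X L v))"
    proof (cases "a = {} \<or> b = {}")
      case False
      then obtain L v M u where a: "a = tuple_cylinder d X L v" and b: "b = tuple_cylinder d X M u"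
        using ab by auto
      have "a \<inter> b \<in> {{}, a, b}"
      proof (cases "L \<le> M")
        case True
        then show ?thesis using *[of L M v u] unfolding a b by blast
      next
        case False
        then show ?thesis using *[of M L u v] unfolding a b by (auto simp: Int_commute)
      qed
      then show ?thesis using ab by auto
    qed auto
  qed
qed

lemma coord_map_measurable:
  assumes "f permutes {1..d}" shows "coord_map d f \<in> measurable (borel_power d X) (borel_power d X)"
  unfolding coord_map_def
  by (rule measurable_restrict, rule measurable_component_singleton)
    (use permutes_in_image[OF assms] in simp)

text \<open>
  A family with the same values as the injective \<open>v\<close> is injective by counting, so the values
  are matched by a permutation.
\<close>

lemma matching_permutation:
  assumes "finite I" "inj_on v I" "g ` I = v ` I"
  obtains f where "f permutes I" "\<And>i. i \<in> I \<Longrightarrow> g (f i) = v i"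
proof -
  have "card (g ` I) = card I" using assms(2,3) by (simp add: card_image)
  then have g: "inj_on g I" by (rule eq_card_imp_inj_on[OF assms(1)])
  define f where "f i = (if i \<in> I then inv_into I g (v i) else i)" for i
  have "bij_betw v I (g ` I)" using assms(2,3) by (simp add: bij_betw_def)
  moreover have "bij_betw (inv_into I g) (g ` I) I" by (rule bij_betw_inv_into[OF inj_on_imp_bij_betw[OF g]])
  ultimately have "bij_betw (inv_into I g \<circ> v) I I" by (rule bij_betw_trans)
  then have "bij_betw f I I" by (subst bij_betw_cong[of _ _ "inv_into I g \<circ> v"]) (simp_all add: f_def)
  then have "f permutes I" by (rule bij_imp_permutes) (simp add: f_def)
  moreover have "g (f i) = v i" if i: "i \<in> I" for i
  proof -
    have "v i \<in> g ` I" using assms(3) i by blast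
    then show ?thesis using f_inv_into_f[of "v i" g I] i by (simp add: f_def)
  qed
  ultimately show ?thesis using that by blast
qed

section \<open>Uniqueness of the symmetrised degree joining\<close>

context sofic_code
begin

abbreviation "d \<equiv> code_degree X Y \<pi>"

definition permuted :: "(nat \<Rightarrow> int \<Rightarrow> 'a) measure \<Rightarrow> (nat \<Rightarrow> nat) \<Rightarrow> (nat \<Rightarrow> int \<Rightarrow> 'a) measure" where
  "permuted \<mu> f = distr \<mu> (borel_power d X) (coord_map d f)"

text \<open>
  Summing over all rearrangements forgets the order in which the points of a fibre are listed,
  and that order is the only thing that \<open>\<nu>\<close> does not determine.
\<close>

definition symmetrised :: "(nat \<Rightarrow> int \<Rightarrow> 'a) measure \<Rightarrow> (nat \<Rightarrow> int \<Rightarrow> 'a) set \<Rightarrow> real" where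
  "symmetrised \<mu> A = (\<Sum>f | f permutes {1..d}. measure (permuted \<mu> f) A)"

text \<open>
  The set of \<open>y\<close> whose fibre shows a given window is an image of a compact set and need not be
  open. Writing it as the intersection over \<open>M\<close> of the conditions on the blocks of radius
  \<open>M\<close> makes it visibly Borel.
\<close>

lemma fibre_windows_sets: "{y \<in> Y. window L ` fibre y = V} \<in> sets (borel_on Y)"
proof (cases "V \<subseteq> window L ` X")
  case False
  have "{y \<in> Y. window L ` fibre y = V} = {}" using False unfolding fibre_def by blast
  then show ?thesis by (simp only: sets.empty_sets)
next
  case True
  have sp: "space (borel_on Y) = Y" by (simp add: space_restrict_space)
  have m: "{y \<in> Y. w \<in> window L ` fibre y} \<in> sets (borel_on Y)" for w
  proof -
    have "w \<in> window L ` fibre y \<longleftrightarrow> (\<forall>M. w \<in> pre_windows y M L)" for y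
    proof
      assume "w \<in> window L ` fibre y"
      then show "\<forall>M. w \<in> pre_windows y M L" unfolding fibre_def pre_windows_def by blast
    next
      assume *: "\<forall>M. w \<in> pre_windows y M L"
      obtain M where "pre_windows y M L = window L ` fibre y"
        using pre_windows_eventually_fibre[of y L] by blast
      then show "w \<in> window L ` fibre y" using *[rule_format, of M] by simp
    qed
    then have "{y \<in> Y. w \<in> window L ` fibre y} = (\<Inter>M. {y \<in> Y. w \<in> pre_windows y M L})" by auto
    also have "\<dots> \<in> sets (borel_on Y)"
    proof (rule sets.countable_INT)
      have "{y \<in> Y. w \<in> pre_windows y M L} \<in> sets (borel_on Y)" for M
        unfolding pre_windows_def
        using window_pred_sets[of Y "\<lambda>u. w \<in> window L ` {x \<in> X. window M (\<pi> x) = u}" M] .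
      then show "range (\<lambda>M. {y \<in> Y. w \<in> pre_windows y M L}) \<subseteq> sets (borel_on Y)" by blast
    qed simp
    finally show ?thesis .
  qed
  have "{y \<in> space (borel_on Y). w \<in> window L ` fibre y \<longleftrightarrow> w \<in> V} \<in> sets (borel_on Y)" for w
  proof (cases "w \<in> V")
    case True
    then have "{y \<in> space (borel_on Y). w \<in> window L ` fibre y \<longleftrightarrow> w \<in> V} = {y \<in> Y. w \<in> window L ` fibre y}"
      unfolding sp by blast
    then show ?thesis using m by (simp only:)
  next
    case False
    then have "{y \<in> space (borel_on Y). w \<in> window L ` fibre y \<longleftrightarrow> w \<in> V}
        = space (borel_on Y) - {y \<in> Y. w \<in> window L ` fibre y}"
      unfolding sp by blast
    then show ?thesis using sets.Diff[OF sets.top m] by (simp only:)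
  qed
  then have "{y \<in> space (borel_on Y). \<forall>w\<in>window L ` X. w \<in> window L ` fibre y \<longleftrightarrow> w \<in> V} \<in> sets (borel_on Y)"
    by (rule sets.sets_Collect_finite_All[OF _ finite_windows[OF shift_X]])
  moreover have "(\<forall>w\<in>window L ` X. w \<in> window L ` fibre y \<longleftrightarrow> w \<in> V) \<longleftrightarrow> window L ` fibre y = V" for y
    using True unfolding fibre_def by blast
  ultimately show ?thesis unfolding sp by simp
qed

lemma degree_joining_sets: "degree_joining X Y \<pi> \<nu> \<mu> \<Longrightarrow> sets \<mu> = sets (borel_power d X)"
  unfolding degree_joining_def relative_joining_def by blast

lemma degree_joining_space: "degree_joining X Y \<pi> \<nu> \<mu> \<Longrightarrow> space \<mu> = (\<Pi>\<^sub>E i\<in>{1..d}. X)"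
  using sets_eq_imp_space_eq[OF degree_joining_sets] space_borel_power by blast

lemma degree_joining_prob: "degree_joining X Y \<pi> \<nu> \<mu> \<Longrightarrow> prob_space \<mu>"
  unfolding degree_joining_def ergodic_prob_def invariant_prob_def by blast

lemma degree_joining_coord_map:
  assumes "degree_joining X Y \<pi> \<nu> \<mu>" "f permutes {1..d}"
  shows "coord_map d f \<in> measurable \<mu> (borel_power d X)"
  using coord_map_measurable[OF assms(2)] measurable_cong_sets[OF degree_joining_sets[OF assms(1)] refl]
  by blast

lemma code_measurable: "\<pi> \<in> measurable (borel_on X) (borel_on Y)"
proof (rule measurable_restrict_space2)
  show "\<pi> \<in> space (borel_on X) \<rightarrow> Y" using image_in by (auto simp: space_restrict_space)
  show "\<pi> \<in> borel_measurable (borel_on X)"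
    using code unfolding factor_code_def by (blast intro: borel_measurable_continuous_on_restrict)
qed

text \<open>
  The entries of a tuple are \<open>d\<close> distinct points of one fibre, and over a doubly transitive
  point the fibre has no others.
\<close>

lemma degree_joining_enumerates_fibres:
  assumes dj: "degree_joining X Y \<pi> \<nu> \<mu>" and \<nu>: "ergodic_measure_on Y \<nu>" "fully_supported_on Y \<nu>"
  shows "\<exists>i\<in>{1..d}. (\<lambda>x. \<pi> (x i)) \<in> measurable \<mu> (borel_on Y) \<and>
    distr \<mu> (borel_on Y) (\<lambda>x. \<pi> (x i)) = \<nu> \<and>
    (AE x in \<mu>. inj_on x {1..d} \<and> x ` {1..d} = fibre (\<pi> (x i)))"
proof -
  obtain i where i: "i \<in> {1..d}" and distr: "distr \<mu> (borel_on Y) (\<lambda>x. \<pi> (x i)) = \<nu>"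
    using dj unfolding degree_joining_def joining_over_def by blast
  have "(\<lambda>x. x i) \<in> measurable (borel_power d X) (borel_on X)"
    by (rule measurable_component_singleton[OF i])
  then have "(\<lambda>x. \<pi> (x i)) \<in> measurable (borel_power d X) (borel_on Y)"
    by (rule measurable_compose[OF _ code_measurable])
  then have meas: "(\<lambda>x. \<pi> (x i)) \<in> measurable \<mu> (borel_on Y)"
    using measurable_cong_sets[OF degree_joining_sets[OF dj] refl] by blast
  have dt: "AE x in \<mu>. doubly_transitive Y (\<pi> (x i))"
    by (rule AE_distrD[OF meas]) (unfold distr, rule AE_doubly_transitive[OF shift_Y \<nu>])
  have sep: "AE x in \<mu>. inj_on x {1..d}"
    using dj unfolding degree_joining_def separating_def by blast
  have rel: "AE x in \<mu>. \<forall>i\<in>{1..d}. \<forall>j\<in>{1..d}. \<pi> (x i) = \<pi> (x j)"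
    using dj unfolding degree_joining_def relative_joining_def by blast
  have "AE x in \<mu>. doubly_transitive Y (\<pi> (x i)) \<and> inj_on x {1..d} \<and>
      (\<forall>i\<in>{1..d}. \<forall>j\<in>{1..d}. \<pi> (x i) = \<pi> (x j))"
    by (intro AE_conjI dt sep rel)
  then have "AE x in \<mu>. inj_on x {1..d} \<and> x ` {1..d} = fibre (\<pi> (x i))"
  proof (rule AE_mp, intro AE_I2 impI)
    fix x assume "x \<in> space \<mu>" and *: "doubly_transitive Y (\<pi> (x i)) \<and> inj_on x {1..d} \<and>
      (\<forall>i\<in>{1..d}. \<forall>j\<in>{1..d}. \<pi> (x i) = \<pi> (x j))"
    then have x: "x j \<in> X" if "j \<in> {1..d}" for j
      using that unfolding degree_joining_space[OF dj] by (rule_tac PiE_mem)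
    have "x ` {1..d} \<subseteq> fibre (\<pi> (x i))"
    proof (rule image_subsetI)
      fix j assume j: "j \<in> {1..d}"
      then have "\<pi> (x j) = \<pi> (x i)" using * i by blast
      then show "x j \<in> fibre (\<pi> (x i))" using x[OF j] unfolding fibre_def by simp
    qed
    moreover have "finite (fibre (\<pi> (x i)))"
      by (rule finite_fibre, rule image_in, rule x[OF i])
    moreover have "card (x ` {1..d}) = card (fibre (\<pi> (x i)))"
      using card_fibre_eq_code_degree * card_image[of x "{1..d}"] by simp
    ultimately have "x ` {1..d} = fibre (\<pi> (x i))" using card_subset_eq by blast
    then show "inj_on x {1..d} \<and> x ` {1..d} = fibre (\<pi> (x i))" using * by blast
  qed
  then show ?thesis using i meas distr by blast
qed

text \<open>
  If \<open>v\<close> consists of distinct windows, then a tuple listing the fibre of \<open>y\<close> has exactly one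
  rearrangement in the cylinder when the windows of the fibre are those of \<open>v\<close>, and none
  otherwise. So the sum over the permutations counts the event that the fibre shows the windows
  of \<open>v\<close>, which only depends on \<open>\<nu>\<close>.
\<close>

lemma symmetrised_injective_cylinder:
  assumes dj: "degree_joining X Y \<pi> \<nu> \<mu>" and \<nu>: "ergodic_measure_on Y \<nu>" "fully_supported_on Y \<nu>"
    and inj: "inj_on v {1..d}"
  shows "symmetrised \<mu> (tuple_cylinder d X L v) = measure \<nu> {y \<in> Y. window L ` fibre y = v ` {1..d}}"
proof -
  interpret prob_space \<mu> by (rule degree_joining_prob[OF dj])
  let ?I = "{1..d}" and ?S = "{y \<in> Y. window L ` fibre y = v ` {1..d}}"
  obtain k where k: "k \<in> ?I" and meas: "(\<lambda>x. \<pi> (x k)) \<in> measurable \<mu> (borel_on Y)"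
    and distr: "distr \<mu> (borel_on Y) (\<lambda>x. \<pi> (x k)) = \<nu>"
    and enum: "AE x in \<mu>. inj_on x ?I \<and> x ` ?I = fibre (\<pi> (x k))"
    using degree_joining_enumerates_fibres[OF dj \<nu>] by blast
  define A where "A f = coord_map d f -` tuple_cylinder d X L v \<inter> space \<mu>" for f
  have A: "A f \<in> sets \<mu>" if "f permutes ?I" for f
    unfolding A_def by (rule measurable_sets[OF degree_joining_coord_map[OF dj that] tuple_cylinder_sets])
  have A_iff: "x \<in> A f \<longleftrightarrow> x \<in> space \<mu> \<and> (\<forall>i\<in>?I. window L (x (f i)) = v i)" if f: "f permutes ?I" for x f
  proof -
    have "coord_map d f x \<in> (\<Pi>\<^sub>E i\<in>?I. X)" if "x \<in> space \<mu>"
      using measurable_space[OF degree_joining_coord_map[OF dj f] that] unfolding space_borel_power .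
    then show ?thesis unfolding A_def tuple_cylinder_def by (auto simp: coord_map_def)
  qed
  have disj: "disjoint_family_on A {f. f permutes ?I}"
    unfolding disjoint_family_on_def
  proof (intro ballI impI)
    fix f g assume fg: "f \<in> {f. f permutes ?I}" "g \<in> {f. f permutes ?I}" "f \<noteq> g"
    then have f: "f permutes ?I" and g: "g permutes ?I" by simp_all
    show "A f \<inter> A g = {}"
    proof (rule ccontr)
      assume "A f \<inter> A g \<noteq> {}"
      then obtain x where x: "x \<in> A f" "x \<in> A g" by blast
      have xf: "window L (x (f i)) = v i" and xg: "window L (x (g i)) = v i" if "i \<in> ?I" for i
        using x that A_iff[OF f] A_iff[OF g] by blast+
      have "f i = g i" for i
      proof (cases "i \<in> ?I")
        case True
        obtain j where j: "j \<in> ?I" "f j = g i"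
          using permutes_image[OF f] permutes_in_image[OF g] True by (metis imageE)
        have "v j = v i" using xf[OF j(1)] xg[OF True] j(2) by simp
        then have "j = i" using inj j(1) True by (rule_tac inj_onD)
        then show ?thesis using j(2) by simp
      qed (use permutes_not_in[OF f] permutes_not_in[OF g] in simp)
      then show False using fg(3) by blast
    qed
  qed
  have fin: "finite {f. f permutes ?I}" by (rule finite_permutations) simp
  have pre: "(\<lambda>x. \<pi> (x k)) -` ?S \<inter> space \<mu> \<in> sets \<mu>" by (rule measurable_sets[OF meas fibre_windows_sets])
  have U: "(\<Union>f\<in>{f. f permutes ?I}. A f) \<in> sets \<mu>" using A by (intro sets.finite_UN fin) simp
  have "symmetrised \<mu> (tuple_cylinder d X L v) = (\<Sum>f | f permutes ?I. measure \<mu> (A f))"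
    unfolding symmetrised_def permuted_def A_def
    by (intro sum.cong refl measure_distr degree_joining_coord_map[OF dj] tuple_cylinder_sets) simp
  also have "\<dots> = measure \<mu> (\<Union>f\<in>{f. f permutes ?I}. A f)"
    by (rule finite_measure_finite_Union[OF fin _ disj, symmetric]) (use A in blast)
  also have "\<dots> = measure \<mu> ((\<lambda>x. \<pi> (x k)) -` ?S \<inter> space \<mu>)"
  proof (rule finite_measure_eq_AE[OF _ U pre])
    show "AE x in \<mu>. x \<in> (\<Union>f\<in>{f. f permutes ?I}. A f) \<longleftrightarrow> x \<in> (\<lambda>x. \<pi> (x k)) -` ?S \<inter> space \<mu>"
      using enum
    proof (rule AE_mp, intro AE_I2 impI)
      fix x assume x: "x \<in> space \<mu>" and "inj_on x ?I \<and> x ` ?I = fibre (\<pi> (x k))"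
      then have fib: "fibre (\<pi> (x k)) = x ` ?I" by blast
      have "\<pi> (x k) \<in> Y" using measurable_space[OF meas x] by (simp add: space_restrict_space)
      then have "x \<in> (\<lambda>x. \<pi> (x k)) -` ?S \<inter> space \<mu> \<longleftrightarrow> (\<lambda>i. window L (x i)) ` ?I = v ` ?I"
        using x by (simp add: fib image_image)
      also have "\<dots> \<longleftrightarrow> (\<exists>f. f permutes ?I \<and> (\<forall>i\<in>?I. window L (x (f i)) = v i))"
      proof
        assume eq: "(\<lambda>i. window L (x i)) ` ?I = v ` ?I"
        obtain f where "f permutes ?I" "\<And>i. i \<in> ?I \<Longrightarrow> window L (x (f i)) = v i"
          by (rule matching_permutation[OF _ inj eq]) auto
        then show "\<exists>f. f permutes ?I \<and> (\<forall>i\<in>?I. window L (x (f i)) = v i)" by blast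
      next
        assume "\<exists>f. f permutes ?I \<and> (\<forall>i\<in>?I. window L (x (f i)) = v i)"
        then obtain f where f: "f permutes ?I" "\<forall>i\<in>?I. window L (x (f i)) = v i" by blast
        have "(\<lambda>i. window L (x i)) ` ?I = (\<lambda>i. window L (x i)) ` f ` ?I" unfolding permutes_image[OF f(1)] ..
        also have "\<dots> = v ` ?I" unfolding image_image using f(2) by (intro image_cong) auto
        finally show "(\<lambda>i. window L (x i)) ` ?I = v ` ?I" .
      qed
      also have "\<dots> \<longleftrightarrow> x \<in> (\<Union>f\<in>{f. f permutes ?I}. A f)" using A_iff x by auto
      finally show "x \<in> (\<Union>f\<in>{f. f permutes ?I}. A f) \<longleftrightarrow> x \<in> (\<lambda>x. \<pi> (x k)) -` ?S \<inter> space \<mu>" by blast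
    qed
  qed
  also have "\<dots> = measure \<nu> ?S"
    unfolding distr[symmetric] by (rule measure_distr[OF meas fibre_windows_sets, symmetric])
  finally show ?thesis .
qed

definition separated :: "nat \<Rightarrow> (nat \<Rightarrow> int \<Rightarrow> 'a) set" where
  "separated M = {x. inj_on (\<lambda>i. window M (x i)) {1..d}}"

text \<open>
  The finer tuples of windows inside a cylinder, restricted to those to which
  \<open>symmetrised_injective_cylinder\<close> applies.
\<close>

definition refinements :: "nat \<Rightarrow> (nat \<Rightarrow> int \<Rightarrow> 'a) \<Rightarrow> nat \<Rightarrow> (nat \<Rightarrow> int \<Rightarrow> 'a) set" where
  "refinements L v M = {u \<in> \<Pi>\<^sub>E i\<in>{1..d}. window M ` X. inj_on u {1..d} \<and> (\<forall>i\<in>{1..d}. window L (u i) = v i)}"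

lemma finite_refinements: "finite (refinements L v M)"
proof (rule finite_subset)
  show "refinements L v M \<subseteq> (\<Pi>\<^sub>E i\<in>{1..d}. window M ` X)" unfolding refinements_def by blast
  show "finite (\<Pi>\<^sub>E i\<in>{1..d}. window M ` X)" by (intro finite_PiE finite_windows[OF shift_X]) simp
qed

lemma cylinder_separated:
  assumes "L \<le> M"
  shows "tuple_cylinder d X L v \<inter> separated M = (\<Union>u\<in>refinements L v M. tuple_cylinder d X M u)"
proof
  show "tuple_cylinder d X L v \<inter> separated M \<subseteq> (\<Union>u\<in>refinements L v M. tuple_cylinder d X M u)"
  proof
    fix x assume x: "x \<in> tuple_cylinder d X L v \<inter> separated M"
    let ?u = "\<lambda>i\<in>{1..d}. window M (x i)"
    have xX: "x i \<in> X" if "i \<in> {1..d}" for i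
      using x that unfolding tuple_cylinder_def by (auto dest: PiE_mem)
    have "?u \<in> (\<Pi>\<^sub>E i\<in>{1..d}. window M ` X)" using xX by auto
    moreover have "inj_on ?u {1..d}" using x unfolding separated_def inj_on_restrict_eq by blast
    moreover have "\<forall>i\<in>{1..d}. window L (?u i) = v i"
    proof
      fix i assume i: "i \<in> {1..d}"
      then have "window L (?u i) = window L (x i)" by (simp add: window_window[OF assms])
      also have "\<dots> = v i" using x i unfolding tuple_cylinder_def by blast
      finally show "window L (?u i) = v i" .
    qed
    ultimately have "?u \<in> refinements L v M" unfolding refinements_def by blast
    moreover have "x \<in> tuple_cylinder d X M ?u" using x unfolding tuple_cylinder_def by simp
    ultimately show "x \<in> (\<Union>u\<in>refinements L v M. tuple_cylinder d X M u)" by blast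
  qed
  show "(\<Union>u\<in>refinements L v M. tuple_cylinder d X M u) \<subseteq> tuple_cylinder d X L v \<inter> separated M"
  proof (rule UN_least)
    fix u assume u: "u \<in> refinements L v M"
    show "tuple_cylinder d X M u \<subseteq> tuple_cylinder d X L v \<inter> separated M"
    proof
      fix x assume "x \<in> tuple_cylinder d X M u"
      then have x: "x \<in> (\<Pi>\<^sub>E i\<in>{1..d}. X)" "\<forall>i\<in>{1..d}. window M (x i) = u i"
        unfolding tuple_cylinder_def by simp_all
      have "window L (x i) = v i" if "i \<in> {1..d}" for i
      proof -
        have "window L (x i) = window L (window M (x i))" by (rule window_window[OF assms, symmetric])
        also have "\<dots> = window L (u i)" using x(2) that by simp
        also have "\<dots> = v i" using u that unfolding refinements_def by blast
        finally show ?thesis .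
      qed
      moreover have "inj_on (\<lambda>i. window M (x i)) {1..d}"
      proof -
        have "inj_on u {1..d}" using u unfolding refinements_def by blast
        then show ?thesis by (subst inj_on_cong[of _ _ u]) (use x(2) in blast)+
      qed
      ultimately show "x \<in> tuple_cylinder d X L v \<inter> separated M"
        using x(1) unfolding tuple_cylinder_def separated_def by simp
    qed
  qed
qed

lemma disjoint_refinements: "disjoint_family_on (tuple_cylinder d X M) (refinements L v M)"
  unfolding disjoint_family_on_def
proof (intro ballI impI)
  fix u w assume u: "u \<in> refinements L v M" and w: "w \<in> refinements L v M" and "u \<noteq> w"
  show "tuple_cylinder d X M u \<inter> tuple_cylinder d X M w = {}"
  proof (rule ccontr)
    assume "tuple_cylinder d X M u \<inter> tuple_cylinder d X M w \<noteq> {}"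
    then obtain x where x: "x \<in> tuple_cylinder d X M u" "x \<in> tuple_cylinder d X M w" by blast
    have "u i = w i" if "i \<in> {1..d}" for i
    proof -
      have "window M (x i) = u i" "window M (x i) = w i" using x that unfolding tuple_cylinder_def by blast+
      then show ?thesis by simp
    qed
    moreover have "u \<in> (\<Pi>\<^sub>E i\<in>{1..d}. window M ` X)" "w \<in> (\<Pi>\<^sub>E i\<in>{1..d}. window M ` X)"
      using u w unfolding refinements_def by blast+
    ultimately have "u = w" by (rule_tac PiE_ext)
    then show False using \<open>u \<noteq> w\<close> by blast
  qed
qed

lemma cylinder_separated_sets:
  assumes "L \<le> M"
  shows "tuple_cylinder d X L v \<inter> separated M \<in> sets (borel_power d X)"
  unfolding cylinder_separated[OF assms] by (intro sets.finite_UN finite_refinements tuple_cylinder_sets)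

context
  fixes \<nu> \<mu>
  assumes dj: "degree_joining X Y \<pi> \<nu> \<mu>"
begin

lemma permuted_prob: "f permutes {1..d} \<Longrightarrow> prob_space (permuted \<mu> f)"
  unfolding permuted_def
  by (rule prob_space.prob_space_distr[OF degree_joining_prob[OF dj] degree_joining_coord_map[OF dj]])

lemma sets_permuted: "sets (permuted \<mu> f) = sets (borel_power d X)"
  by (simp add: permuted_def)

lemma space_permuted: "space (permuted \<mu> f) = (\<Pi>\<^sub>E i\<in>{1..d}. X)"
  unfolding permuted_def space_distr by (rule space_borel_power)

lemma symmetrised_refinements:
  assumes "L \<le> M"
  shows "symmetrised \<mu> (tuple_cylinder d X L v \<inter> separated M)
    = (\<Sum>u\<in>refinements L v M. symmetrised \<mu> (tuple_cylinder d X M u))"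
proof -
  have "measure (permuted \<mu> f) (tuple_cylinder d X L v \<inter> separated M)
      = (\<Sum>u\<in>refinements L v M. measure (permuted \<mu> f) (tuple_cylinder d X M u))"
    if f: "f permutes {1..d}" for f
  proof -
    interpret prob_space "permuted \<mu> f" by (rule permuted_prob[OF f])
    show ?thesis
      unfolding cylinder_separated[OF assms]
      by (rule finite_measure_finite_Union[OF finite_refinements _ disjoint_refinements])
        (use tuple_cylinder_sets sets_permuted in blast)
  qed
  then have "symmetrised \<mu> (tuple_cylinder d X L v \<inter> separated M)
      = (\<Sum>f | f permutes {1..d}. \<Sum>u\<in>refinements L v M. measure (permuted \<mu> f) (tuple_cylinder d X M u))"
    unfolding symmetrised_def by (intro sum.cong refl) simp
  also have "\<dots> = (\<Sum>u\<in>refinements L v M. symmetrised \<mu> (tuple_cylinder d X M u))"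
    unfolding symmetrised_def by (rule sum.swap)
  finally show ?thesis .
qed

text \<open>
  Distinct points have distinct windows of large radius, so the tuples of a separating joining
  are eventually separated.
\<close>

lemma symmetrised_limit:
  "(\<lambda>M. symmetrised \<mu> (tuple_cylinder d X L v \<inter> separated (L + M))) \<longlonglongrightarrow> symmetrised \<mu> (tuple_cylinder d X L v)"
  unfolding symmetrised_def
proof (rule tendsto_sum)
  fix f assume "f \<in> {f. f permutes {1..d}}"
  then have f: "f permutes {1..d}" by simp
  interpret P: prob_space "permuted \<mu> f" by (rule permuted_prob[OF f])
  interpret prob_space \<mu> by (rule degree_joining_prob[OF dj])
  let ?C = "tuple_cylinder d X L v" and ?D = "\<lambda>M. tuple_cylinder d X L v \<inter> separated (L + M)"
  have D: "?D M \<in> sets (borel_power d X)" for M by (rule cylinder_separated_sets) simp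
  have UD: "(\<Union>M. ?D M) \<in> sets (borel_power d X)" using D by blast
  have "incseq ?D"
  proof (rule monoI)
    fix M N :: nat assume "M \<le> N"
    have "x \<in> separated (L + N)" if x: "x \<in> separated (L + M)" for x
      unfolding separated_def
    proof (intro CollectI inj_onI)
      fix i j assume ij: "i \<in> {1..d}" "j \<in> {1..d}" and w: "window (L + N) (x i) = window (L + N) (x j)"
      have "window (L + M) (x i) = window (L + M) (x j)"
        by (rule window_mono[OF w]) (use \<open>M \<le> N\<close> in simp)
      moreover have inj: "inj_on (\<lambda>i. window (L + M) (x i)) {1..d}" using x unfolding separated_def by blast
      ultimately show "i = j" by (intro inj_onD[OF inj _ ij])
    qed
    then show "?D M \<le> ?D N" by blast
  qed
  then have "(\<lambda>M. measure (permuted \<mu> f) (?D M)) \<longlonglongrightarrow> measure (permuted \<mu> f) (\<Union>M. ?D M)"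
    by (intro P.finite_Lim_measure_incseq) (use D sets_permuted in blast)+
  moreover have "measure (permuted \<mu> f) (\<Union>M. ?D M) = measure (permuted \<mu> f) ?C"
  proof -
    note g = degree_joining_coord_map[OF dj f]
    have "measure \<mu> (coord_map d f -` (\<Union>M. ?D M) \<inter> space \<mu>) = measure \<mu> (coord_map d f -` ?C \<inter> space \<mu>)"
    proof (rule finite_measure_eq_AE[OF _ measurable_sets[OF g UD] measurable_sets[OF g tuple_cylinder_sets]])
      have "AE x in \<mu>. inj_on x {1..d}"
        using dj unfolding degree_joining_def separating_def by blast
      then show "AE x in \<mu>. x \<in> coord_map d f -` (\<Union>M. ?D M) \<inter> space \<mu> \<longleftrightarrow> x \<in> coord_map d f -` ?C \<inter> space \<mu>"
      proof (rule AE_mp, intro AE_I2 impI)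
        fix x assume "x \<in> space \<mu>" and x: "inj_on x {1..d}"
        obtain T where T: "inj_on (window T) (x ` {1..d})"
          using finite_separating_window[of "x ` {1..d}"] by blast
        have "coord_map d f x \<in> separated (L + T)"
          unfolding separated_def
        proof (intro CollectI inj_onI)
          fix i j assume ij: "i \<in> {1..d}" "j \<in> {1..d}"
            and w: "window (L + T) (coord_map d f x i) = window (L + T) (coord_map d f x j)"
          have "window (L + T) (x (f i)) = window (L + T) (x (f j))"
            using w ij unfolding coord_map_def by (simp only: restrict_apply' )
          then have "window T (x (f i)) = window T (x (f j))" by (rule window_mono) simp
          moreover have fij: "f i \<in> {1..d}" "f j \<in> {1..d}" using ij permutes_in_image[OF f] by blast+
          ultimately have "x (f i) = x (f j)" using T by (meson imageI inj_onD)
          then have "f i = f j" using x fij by (meson inj_onD)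
          then show "i = j" using permutes_inj[OF f] by (meson injD)
        qed
        then show "x \<in> coord_map d f -` (\<Union>M. ?D M) \<inter> space \<mu> \<longleftrightarrow> x \<in> coord_map d f -` ?C \<inter> space \<mu>"
          by blast
      qed
    qed
    then show ?thesis
      unfolding permuted_def measure_distr[OF g UD] measure_distr[OF g tuple_cylinder_sets] .
  qed
  ultimately show "(\<lambda>M. measure (permuted \<mu> f) (?D M)) \<longlonglongrightarrow> measure (permuted \<mu> f) ?C" by simp
qed

lemma symmetrised_compl:
  assumes "A \<in> sets (borel_power d X)"
  shows "symmetrised \<mu> ((\<Pi>\<^sub>E i\<in>{1..d}. X) - A) = (\<Sum>f | f permutes {1..d}. 1) - symmetrised \<mu> A"
proof -
  have "measure (permuted \<mu> f) ((\<Pi>\<^sub>E i\<in>{1..d}. X) - A) = 1 - measure (permuted \<mu> f) A"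
    if f: "f permutes {1..d}" for f
    using prob_space.prob_compl[OF permuted_prob[OF f], of A] assms
    unfolding sets_permuted space_permuted by blast
  then show ?thesis unfolding symmetrised_def sum_subtractf[symmetric] by (intro sum.cong refl) simp
qed

lemma symmetrised_sums:
  assumes "range A \<subseteq> sets (borel_power d X)" "disjoint_family A"
  shows "(\<lambda>n::nat. symmetrised \<mu> (A n)) sums symmetrised \<mu> (\<Union>n. A n)"
  unfolding symmetrised_def
proof (rule sums_sum)
  fix f assume "f \<in> {f. f permutes {1..d}}"
  then interpret prob_space "permuted \<mu> f" by (intro permuted_prob) simp
  show "(\<lambda>n. measure (permuted \<mu> f) (A n)) sums measure (permuted \<mu> f) (\<Union>n. A n)"
    by (rule finite_measure_UNION[OF _ assms(2)]) (simp only: sets_permuted assms(1))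
qed

lemma permuted_ergodic:
  assumes f: "f permutes {1..d}" shows "ergodic_prob (power_shift d) (permuted \<mu> f)"
  unfolding permuted_def
proof (rule ergodic_prob_distr[OF _ degree_joining_coord_map[OF dj f]])
  show erg: "ergodic_prob (power_shift d) \<mu>" using dj unfolding degree_joining_def by blast
  have "power_shift d \<in> measurable \<mu> \<mu>"
    using erg unfolding ergodic_prob_def invariant_prob_def by blast
  then show "power_shift d \<in> measurable (borel_power d X) (borel_power d X)"
    using measurable_cong_sets[OF degree_joining_sets[OF dj] degree_joining_sets[OF dj]] by blast
  fix x
  show "coord_map d f (power_shift d x) = power_shift d (coord_map d f x)"
    using permutes_in_image[OF f] by (auto simp: coord_map_def power_shift_def restrict_def fun_eq_iff)
qed

lemma permuted_id: "A \<in> sets (borel_power d X) \<Longrightarrow> measure (permuted \<mu> id) A = measure \<mu> A"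
proof -
  assume A: "A \<in> sets (borel_power d X)"
  have "coord_map d id x = x" if "x \<in> space \<mu>" for x
    using that unfolding degree_joining_space[OF dj] coord_map_def by (simp add: PiE_restrict)
  then have "coord_map d id -` A \<inter> space \<mu> = A"
    using sets.sets_into_space[of A \<mu>] A degree_joining_sets[OF dj] by auto
  then show ?thesis
    unfolding permuted_def using measure_distr[OF degree_joining_coord_map[OF dj permutes_id] A] by simp
qed

end

text \<open>
  The part of a cylinder separated at radius \<open>L + M\<close> is a finite disjoint union of cylinders
  of distinct windows, on which the two sides agree. Letting \<open>M\<close> tend to infinity, they agree
  on all cylinders, hence on the generated sigma-algebra.
\<close>

lemma symmetrised_unique:
  assumes dj: "degree_joining X Y \<pi> \<nu> \<mu>" "degree_joining X Y \<pi> \<nu> \<mu>'"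
    and \<nu>: "ergodic_measure_on Y \<nu>" "fully_supported_on Y \<nu>"
    and A: "A \<in> sets (borel_power d X)"
  shows "symmetrised \<mu> A = symmetrised \<mu>' A"
proof -
  let ?\<Omega> = "\<Pi>\<^sub>E i\<in>{1..d}. X" and ?G = "insert {} (range (\<lambda>(L, v). tuple_cylinder d X L v))"
  have G: "?G \<subseteq> Pow ?\<Omega>" unfolding tuple_cylinder_def by auto
  have G_sets: "?G \<subseteq> sets (borel_power d X)" using tuple_cylinder_sets by auto
  have gen: "B \<in> sets (borel_power d X)" if "B \<in> sigma_sets ?\<Omega> ?G" for B
    using that sets.sigma_sets_subset[OF G_sets] unfolding space_borel_power by blast
  show ?thesis
  proof (rule sigma_sets_induct_disjoint[OF Int_stable_tuple_cylinders G sets_borel_power_generated[OF shift_X A]])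
    fix B assume "B \<in> ?G"
    then consider "B = {}" | L v where "B = tuple_cylinder d X L v" by auto
    then show "symmetrised \<mu> B = symmetrised \<mu>' B"
    proof cases
      case (2 L v)
      have "symmetrised \<mu> (tuple_cylinder d X L v \<inter> separated (L + M))
          = symmetrised \<mu>' (tuple_cylinder d X L v \<inter> separated (L + M))" for M
      proof -
        have "symmetrised \<mu> (tuple_cylinder d X (L + M) u) = symmetrised \<mu>' (tuple_cylinder d X (L + M) u)"
          if "u \<in> refinements L v (L + M)" for u
        proof -
          have "inj_on u {1..d}" using that unfolding refinements_def by blast
          then show ?thesis
            using symmetrised_injective_cylinder[OF dj(1) \<nu>] symmetrised_injective_cylinder[OF dj(2) \<nu>] by simp
        qed
        then show ?thesis
          unfolding symmetrised_refinements[OF dj(1) le_add1] symmetrised_refinements[OF dj(2) le_add1]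
          by (rule sum.cong[OF refl])
      qed
      then have "(\<lambda>M. symmetrised \<mu> (tuple_cylinder d X L v \<inter> separated (L + M))) \<longlonglongrightarrow> symmetrised \<mu>' B"
        using symmetrised_limit[OF dj(2), of L v] unfolding 2 by simp
      then show ?thesis using LIMSEQ_unique symmetrised_limit[OF dj(1), of L v] unfolding 2 by blast
    qed (simp add: symmetrised_def)
  next
    show "symmetrised \<mu> {} = symmetrised \<mu>' {}" by (simp add: symmetrised_def)
  next
    fix B assume "B \<in> sigma_sets ?\<Omega> ?G" "symmetrised \<mu> B = symmetrised \<mu>' B"
    then show "symmetrised \<mu> (?\<Omega> - B) = symmetrised \<mu>' (?\<Omega> - B)"
      using symmetrised_compl[OF dj(1) gen] symmetrised_compl[OF dj(2) gen] by simp
  next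
    fix B :: "nat \<Rightarrow> (nat \<Rightarrow> int \<Rightarrow> 'a) set"
    assume B: "disjoint_family B" "range B \<subseteq> sigma_sets ?\<Omega> ?G" and eq: "\<And>i. symmetrised \<mu> (B i) = symmetrised \<mu>' (B i)"
    have B_sets: "range B \<subseteq> sets (borel_power d X)" using B(2) gen by blast
    have "(\<lambda>n. symmetrised \<mu> (B n)) sums symmetrised \<mu> (\<Union>n. B n)"
      by (rule symmetrised_sums[OF dj(1) B_sets B(1)])
    moreover have "(\<lambda>n. symmetrised \<mu> (B n)) sums symmetrised \<mu>' (\<Union>n. B n)"
      unfolding eq by (rule symmetrised_sums[OF dj(2) B_sets B(1)])
    ultimately show "symmetrised \<mu> (\<Union>n. B n) = symmetrised \<mu>' (\<Union>n. B n)" by (rule sums_unique2)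
  qed
qed

section \<open>Uniqueness of degree joinings up to permutation\<close>

text \<open>
  If \<open>\<mu>'\<close> is none of the rearrangements of \<open>\<mu>\<close>, then as an ergodic measure it is
  singular to each of them and hence to their sum. But that sum is also the sum of the
  rearrangements of \<open>\<mu>'\<close>, one of which is \<open>\<mu>'\<close> itself.
\<close>

theorem degree_joining_unique:
  assumes dj: "degree_joining X Y \<pi> \<nu> \<mu>" "degree_joining X Y \<pi> \<nu> \<mu>'"
    and \<nu>: "ergodic_measure_on Y \<nu>" "fully_supported_on Y \<nu>"
  shows "\<exists>f. f permutes {1..d} \<and> \<mu>' = distr \<mu> (borel_power d X) (coord_map d f)"
proof (rule ccontr)
  assume "\<nexists>f. f permutes {1..d} \<and> \<mu>' = distr \<mu> (borel_power d X) (coord_map d f)"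
  then have ne: "\<mu>' \<noteq> permuted \<mu> f" if "f permutes {1..d}" for f using that unfolding permuted_def by blast
  interpret prob_space \<mu>' by (rule degree_joining_prob[OF dj(2)])
  let ?F = "{f. f permutes {1..d}}"
  have fin: "finite ?F" by (rule finite_permutations) simp
  note sets' = degree_joining_sets[OF dj(2)]
  have "\<exists>B\<in>sets \<mu>'. measure \<mu>' B = 1 \<and> measure (permuted \<mu> f) B = 0" if f: "f permutes {1..d}" for f
  proof (rule ergodic_mutually_singular)
    show "ergodic_prob (power_shift d) \<mu>'" using dj(2) unfolding degree_joining_def by blast
    show "ergodic_prob (power_shift d) (permuted \<mu> f)" by (rule permuted_ergodic[OF dj(1) f])
    show "sets (permuted \<mu> f) = sets \<mu>'" using sets' sets_permuted[OF dj(1)] by simp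
    show "\<mu>' \<noteq> permuted \<mu> f" by (rule ne[OF f])
  qed
  then have "\<forall>f\<in>?F. \<exists>B. B \<in> sets \<mu>' \<and> measure \<mu>' B = 1 \<and> measure (permuted \<mu> f) B = 0" by blast
  then obtain B where B: "\<forall>f\<in>?F. B f \<in> sets \<mu>' \<and> measure \<mu>' (B f) = 1 \<and> measure (permuted \<mu> f) (B f) = 0"
    by (rule bchoice[THEN exE])
  have idF: "id \<in> ?F" by (simp add: permutes_id)
  define C where "C = (\<Inter>f\<in>?F. B f)"
  have C: "C \<in> sets \<mu>'" unfolding C_def
  proof (rule sets.finite_INT[OF fin])
    show "?F \<noteq> {}" using idF by blast
  qed (use B in blast)
  have "\<forall>f\<in>?F. AE x in \<mu>'. x \<in> B f" using B prob_eq_1 by blast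
  then have "AE x in \<mu>'. \<forall>f\<in>?F. x \<in> B f" by (simp only: AE_finite_all[OF fin])
  then have "AE x in \<mu>'. x \<in> C" unfolding C_def by simp
  then have "measure \<mu>' C = 1" using prob_eq_1[OF C] by simp
  have C': "C \<in> sets (borel_power d X)" using C sets' by simp
  have "measure (permuted \<mu> f) C = 0" if f: "f \<in> ?F" for f
  proof -
    have fp: "f permutes {1..d}" using f by simp
    interpret P: prob_space "permuted \<mu> f" by (rule permuted_prob[OF dj(1) fp])
    have "measure (permuted \<mu> f) C \<le> measure (permuted \<mu> f) (B f)"
      by (rule P.finite_measure_mono) (use f B sets' sets_permuted[OF dj(1)] in \<open>auto simp: C_def\<close>)
    moreover have "measure (permuted \<mu> f) (B f) = 0" using B f by blast
    ultimately show ?thesis using measure_nonneg[of "permuted \<mu> f" C] by linarith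
  qed
  then have "symmetrised \<mu> C = 0" unfolding symmetrised_def by (rule sum.neutral[OF ballI])
  then have "symmetrised \<mu>' C = 0" using symmetrised_unique[OF dj \<nu> C'] by simp
  then have "measure (permuted \<mu>' id) C = 0"
    unfolding symmetrised_def using sum_nonneg_eq_0_iff[OF fin, of "\<lambda>f. measure (permuted \<mu>' f) C"] idF by simp
  then show False using permuted_id[OF dj(2) C'] \<open>measure \<mu>' C = 1\<close> by simp
qed

end

theorem theorem4p3:
  fixes X :: "(int \<Rightarrow> 'a::discrete_topology) set"
    and Y :: "(int \<Rightarrow> 'b::discrete_topology) set"
    and \<pi> :: "(int \<Rightarrow> 'a) \<Rightarrow> (int \<Rightarrow> 'b)"
    and \<nu> :: "(int \<Rightarrow> 'b) measure"
    and \<mu> \<mu>' :: "(nat \<Rightarrow> int \<Rightarrow> 'a) measure"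
  assumes "sofic_shift X" and "irreducible_shift X"
    and "factor_code X Y \<pi>" and "finite_to_one X Y \<pi>"
    and "ergodic_measure_on Y \<nu>" and "fully_supported_on Y \<nu>"
    and "degree_joining X Y \<pi> \<nu> \<mu>" and "degree_joining X Y \<pi> \<nu> \<mu>'"
  shows "\<exists>f. f permutes {1..code_degree X Y \<pi>} \<and>
           \<mu>' = distr \<mu> (borel_power (code_degree X Y \<pi>) X) (coord_map (code_degree X Y \<pi>) f)"
proof -
  have "prob_space \<mu>" and "space \<mu> = space (borel_power (code_degree X Y \<pi>) X)"
    using assms(7) sets_eq_imp_space_eq
    unfolding degree_joining_def relative_joining_def invariant_prob_def by blast+
  then obtain x where x: "x \<in> (\<Pi>\<^sub>E i\<in>{1..code_degree X Y \<pi>}. X)"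
    using prob_space.not_empty unfolding space_borel_power by blast
  obtain i where "i \<in> {1..code_degree X Y \<pi>}"
    using assms(7) unfolding degree_joining_def joining_over_def by blast
  then have "X \<noteq> {}" using x by blast
  then obtain m where "synchronizing X m"
    using synchronizing_exists[OF sofic_finite_contexts[OF assms(1)]] by blast
  obtain r where r: "\<forall>x\<in>X. \<forall>z\<in>X. window r x = window r z \<longrightarrow> \<pi> x 0 = \<pi> z 0"
    using factor_code_radius[OF assms(3)] by blast
  interpret sofic_code X Y \<pi> r m
  proof
    show "\<pi> x 0 = \<pi> z 0" if "x \<in> X" "z \<in> X" "window r x = window r z" for x z
      using r that by blast
  qed (fact assms(1-4) \<open>synchronizing X m\<close>)+
  show ?thesis by (rule degree_joining_unique[OF assms(7,8,5,6)])
qed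

end
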